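(* Let $0<k<n$. Consider the map $\Xi:\mathrm{QK}^{GK}(\mathrm{Gr}(k;n))\to\widehat{\mathrm{QK}}(\mathrm{Gr}(k;n))$ of $\mathbb Z[[q]]$-algebras defined by $$\Xi(H_j)=G_j(z)\ \text{ for }1\le j\le n-k,\qquad \Xi(E_j)=G_{1^j}(z)\ \text{ for }1\le j\le k.$$ Then $\Xi$ is an algebra isomorphism.
   Context: Gorbounov–Korff ring: $\mathrm{QK}^{GK}(\mathrm{Gr}(k;n))$ is the quotient of the polynomial ring $\mathbb Z[[q]][H_1,\dots,H_{n-k},E_1,\dots,E_k]$ by the relations given by equating the coefficients of powers of $\xi$ in $$H(\xi)\,E(\ominus\xi)=(\ominus\xi)^k\,\xi^{n-k}(1-H_1)+q,\qquad \ominus\xi:=\frac{-\xi}{1-\xi},$$ (equivalently, after multiplying by $(1-\xi)^k$), where $H(\xi)=\sum_{r=0}^{n-k}(H_r-H_{r+1})\xi^{n-k-r}$, $E(\xi)=\sum_{r=0}^k(E_r-E_{r+1})\xi^{k-r}$, with $E_0=H_0=1$, $H_r=0$ for $r>n-k$, $E_r=0$ for $r>k$. Non-equivariant Coulomb branch ring: with formal variables $z=(z_1,\dots,z_k)$, $\hat z=(\hat z_1,\dots,\hat z_{n-k})$ and elementary symmetric polynomials $e_i$ ($e_0=1$), $$\widehat{\mathrm{QK}}(\mathrm{Gr}(k;n))=\mathbb Z[[q]][e_1(z),\dots,e_k(z),e_1(\hat z),\dots,e_{n-k}(\hat z)]\Big/\Big\langle\sum_{i+j=\ell}e_i(z)e_j(\hat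 z)-\hat g_\ell(z,q)\Big\rangle_{1\le\ell\le n},$$ where $\hat g_\ell(z,q)=c^z_{\ge\ell+1}+(-1)^{n+k}q\binom{k-1}{n-\ell}$ and $c^z_{\ge j}=\sum_{i\ge j}(-1)^{i-j}e_i(z)$ (here $\binom{k-1}{n-\ell}=0$ for $\ell\le n-k$). Grothendieck polynomials: for $j\ge1$, $G_j(z)=h_j(z)-\sum_{a=2}^k(-1)^as_{(j,1^{a-1})}(z)$ ($h_j$ complete homogeneous, $s_\mu$ Schur polynomials), and $G_{1^j}(z)$ is the Grothendieck polynomial of the one-column partition $(1^j)$, determined by $e_\ell(z)=\sum_{j=\ell}^k\binom{j-1}{j-\ell}G_{1^j}(z)$ for $1\le\ell\le k$, i.e. $G_{1^j}(z)=\sum_{i=j}^k(-1)^{i-j}\binom{i-1}{j-1}e_i(z)$. *)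

theory Defs
  imports
    "HOL-Library.Poly_Mapping"
    "HOL-Computational_Algebra.Formal_Power_Series"
    "HOL-Algebra.Algebra"
    "HOL-Algebra.Algebraic_Closure_Type"
begin

section \<open>Polynomials over \<open>\<int>[[q]]\<close>\<close>

text \<open>Polynomials in the variables \<open>'v\<close> with coefficients in \<open>\<int>[[q]]\<close>, the latter being
  \<^typ>\<open>int fps\<close> with \<open>q\<close> represented by \<^const>\<open>fps_X\<close>.\<close>

type_synonym 'v qpoly = "('v \<Rightarrow>\<^sub>0 nat) \<Rightarrow>\<^sub>0 int fps"

definition scalar :: "int fps \<Rightarrow> 'v qpoly" where
  "scalar c = Poly_Mapping.single 0 c"

definition var :: "'v \<Rightarrow> 'v qpoly" where
  "var v = Poly_Mapping.single (Poly_Mapping.single v 1) 1"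

definition q_elem :: "'v qpoly" where
  "q_elem = scalar fps_X"

text \<open>\<open>adjoin S\<close> is \<open>\<int>[[q]][S]\<close>, the \<open>\<int>[[q]]\<close>-subalgebra generated by \<open>S\<close>. If \<open>S\<close> is a
  set of variables, this is the polynomial ring in these variables.\<close>

definition adjoin :: "'v qpoly set \<Rightarrow> 'v qpoly ring" where
  "adjoin S = ring_of_type_algebra
     \<lparr>carrier := generate_ring ring_of_type_algebra (range scalar \<union> S)\<rparr>"


section \<open>Symmetric polynomials in \<open>x 1, \<dots>, x m\<close>\<close>

definition elem_sym :: "nat \<Rightarrow> (nat \<Rightarrow> 'a::comm_ring_1) \<Rightarrow> nat \<Rightarrow> 'a" where
  "elem_sym m x i = (\<Sum>A | A \<subseteq> {1..m} \<and> card A = i. \<Prod>a\<in>A. x a)"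

definition complete_sym :: "nat \<Rightarrow> (nat \<Rightarrow> 'a::comm_ring_1) \<Rightarrow> nat \<Rightarrow> 'a" where
  "complete_sym m x i = (\<Sum>M | set_mset M \<subseteq> {1..m} \<and> size M = i. \<Prod>a\<in>#M. x a)"

text \<open>Partitions are lists of parts; rows and columns of diagrams are numbered from 0.\<close>

definition diagram :: "nat list \<Rightarrow> (nat \<times> nat) set" where
  "diagram \<mu> = {(i, j). i < length \<mu> \<and> j < \<mu> ! i}"

definition ssyt :: "nat \<Rightarrow> nat list \<Rightarrow> (nat \<times> nat \<Rightarrow> nat) set" where
  "ssyt m \<mu> = {T \<in> diagram \<mu> \<rightarrow>\<^sub>E {1..m}.
     (\<forall>i j. (i, Suc j) \<in> diagram \<mu> \<longrightarrow> T (i, j) \<le> T (i, Suc j)) \<and>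
     (\<forall>i j. (Suc i, j) \<in> diagram \<mu> \<longrightarrow> T (i, j) < T (Suc i, j))}"

definition schur :: "nat \<Rightarrow> (nat \<Rightarrow> 'a::comm_ring_1) \<Rightarrow> nat list \<Rightarrow> 'a" where
  "schur m x \<mu> = (\<Sum>T\<in>ssyt m \<mu>. \<Prod>b\<in>diagram \<mu>. x (T b))"

definition groth_row :: "nat \<Rightarrow> (nat \<Rightarrow> 'a::comm_ring_1) \<Rightarrow> nat \<Rightarrow> 'a" where
  "groth_row k x j =
     complete_sym k x j - (\<Sum>a = 2..k. (- 1) ^ a * schur k x (j # replicate (a - 1) 1))"

definition groth_col :: "nat \<Rightarrow> (nat \<Rightarrow> 'a::comm_ring_1) \<Rightarrow> nat \<Rightarrow> 'a" where
  "groth_col k x j =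
     (\<Sum>i = j..k. (- 1) ^ (i - j) * of_nat ((i - 1) choose (j - 1)) * elem_sym k x i)"

lemma elem_sym_eq_groth_col:
  assumes "1 \<le> l" "l \<le> k"
  shows "elem_sym k x l = (\<Sum>j = l..k. of_nat ((j - 1) choose (j - l)) * groth_col k x j)"
proof -
  have inv: "(\<Sum>j = l..i. of_nat ((j - 1) choose (j - l)) *
      ((- 1) ^ (i - j) * of_nat ((i - 1) choose (j - 1)))) = (if i = l then 1 else (0::'a))"
    if "l \<le> i" for i
  proof -
    have "(\<Sum>j = l..i. of_nat ((j - 1) choose (j - l)) *
        ((- 1) ^ (i - j) * of_nat ((i - 1) choose (j - 1)))) =
      (\<Sum>j = l..i. of_nat ((i - 1) choose (l - 1)) *
        ((- 1) ^ (i - j) * of_nat ((i - l) choose (j - l)) :: 'a))"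
    proof (rule sum.cong[OF refl])
      fix j assume j: "j \<in> {l..i}"
      have "(i - 1 choose (j - 1)) * (j - 1 choose (l - 1)) =
          (i - 1 choose (l - 1)) * (i - 1 - (l - 1) choose (j - 1 - (l - 1)))"
        using j assms by (intro choose_mult) auto
      moreover have "(j - 1 choose (l - 1)) = (j - 1 choose (j - l))"
        using j assms binomial_symmetric[of "l - 1" "j - 1"] by auto
      ultimately have "(j - 1 choose (j - l)) * (i - 1 choose (j - 1)) =
          (i - 1 choose (l - 1)) * (i - l choose (j - l))"
        using j assms by (simp add: mult.commute)
      then have "of_nat (j - 1 choose (j - l)) * of_nat (i - 1 choose (j - 1)) =
          (of_nat (i - 1 choose (l - 1)) * of_nat (i - l choose (j - l)) :: 'a)"
        by (metis of_nat_mult)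
      then show "of_nat ((j - 1) choose (j - l)) *
          ((- 1) ^ (i - j) * of_nat ((i - 1) choose (j - 1))) =
          of_nat ((i - 1) choose (l - 1)) *
          ((- 1) ^ (i - j) * of_nat ((i - l) choose (j - l)) :: 'a)"
        by (metis mult.left_commute)
    qed
    also have "\<dots> = of_nat ((i - 1) choose (l - 1)) *
        (\<Sum>j = l..i. (- 1) ^ (i - j) * of_nat ((i - l) choose (j - l)))"
      by (simp add: sum_distrib_left)
    also have "(\<Sum>j = l..i. (- 1) ^ (i - j) * of_nat ((i - l) choose (j - l))) =
        (\<Sum>t\<le>i - l. of_nat ((i - l) choose t) * 1 ^ t * (- 1) ^ (i - l - t) :: 'a)"
      using that
      by (intro sum.reindex_bij_witness[of _ "\<lambda>t. t + l" "\<lambda>j. j - l"]) (auto simp: mult.commute)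
    also have "\<dots> = (1 + (- 1)) ^ (i - l)"
      by (simp only: binomial_ring)
    also have "of_nat ((i - 1) choose (l - 1)) * \<dots> = (if i = l then 1 else 0)"
      using that by (auto simp: power_0_left)
    finally show ?thesis .
  qed
  have "(\<Sum>j = l..k. of_nat ((j - 1) choose (j - l)) * groth_col k x j) =
      (\<Sum>j = l..k. \<Sum>i = j..k. of_nat ((j - 1) choose (j - l)) *
        ((- 1) ^ (i - j) * of_nat ((i - 1) choose (j - 1))) * elem_sym k x i)"
    by (simp add: groth_col_def sum_distrib_left mult.assoc)
  also have "\<dots> = (\<Sum>i = l..k. \<Sum>j = l..i. of_nat ((j - 1) choose (j - l)) *
        ((- 1) ^ (i - j) * of_nat ((i - 1) choose (j - 1))) * elem_sym k x i)"
    unfolding sum.Sigma[OF finite_atLeastAtMost ballI[OF finite_atLeastAtMost]]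
    by (intro sum.reindex_bij_witness[of _ "\<lambda>(a, b). (b, a)" "\<lambda>(a, b). (b, a)"]) auto
  also have "\<dots> = (\<Sum>i = l..k. (if i = l then 1 else 0) * elem_sym k x i)"
    by (intro sum.cong refl, subst inv[symmetric]) (auto simp: sum_distrib_right)
  also have "\<dots> = elem_sym k x l"
    using assms by (simp add: if_distrib[of "\<lambda>c. c * _"] sum.delta cong: if_cong)
  finally show ?thesis by simp
qed


section \<open>The Gorbounov--Korff ring\<close>

datatype gk_var = VarH nat | VarE nat

definition gk_H :: "nat \<Rightarrow> nat \<Rightarrow> nat \<Rightarrow> gk_var qpoly" where
  "gk_H k n r = (if r = 0 then 1 else if r \<le> n - k then var (VarH r) else 0)"

definition gk_E :: "nat \<Rightarrow> nat \<Rightarrow> gk_var qpoly" where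
  "gk_E k r = (if r = 0 then 1 else if r \<le> k then var (VarE r) else 0)"

text \<open>Power series in \<open>\<xi>\<close> are represented by \<^typ>\<open>gk_var qpoly fps\<close>, so that here
  \<^const>\<open>fps_X\<close> is \<open>\<xi>\<close> and not \<open>q\<close>.\<close>

definition gk_H_series :: "nat \<Rightarrow> nat \<Rightarrow> gk_var qpoly fps \<Rightarrow> gk_var qpoly fps" where
  "gk_H_series k n \<xi> =
     (\<Sum>r = 0..n - k. fps_const (gk_H k n r - gk_H k n (r + 1)) * \<xi> ^ (n - k - r))"

definition gk_E_series :: "nat \<Rightarrow> gk_var qpoly fps \<Rightarrow> gk_var qpoly fps" where
  "gk_E_series k \<xi> = (\<Sum>r = 0..k. fps_const (gk_E k r - gk_E k (r + 1)) * \<xi> ^ (k - r))"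

text \<open>\<open>\<ominus>\<xi> = - \<xi> / (1 - \<xi>) = - \<xi> - \<xi>\<^sup>2 - \<dots>\<close>. There is no division of power series over a
  general commutative ring in the library, hence the explicit coefficients.\<close>

definition ominus_xi :: "'a::comm_ring_1 fps" where
  "ominus_xi = Abs_fps (\<lambda>i. if i = 0 then 0 else - 1)"

lemma ominus_xi: "(1 - fps_X) * ominus_xi = - (fps_X :: 'a::comm_ring_1 fps)"
  by (rule fps_ext) (auto simp: ominus_xi_def left_diff_distrib)

definition gk_relations :: "nat \<Rightarrow> nat \<Rightarrow> gk_var qpoly set" where
  "gk_relations k n = range (fps_nth
     (gk_H_series k n fps_X * gk_E_series k ominus_xi
      - (ominus_xi ^ k * fps_X ^ (n - k) * fps_const (1 - gk_H k n 1) + fps_const q_elem)))"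

definition gk_poly_ring :: "nat \<Rightarrow> nat \<Rightarrow> gk_var qpoly ring" where
  "gk_poly_ring k n = adjoin (gk_H k n ` {1..n - k} \<union> gk_E k ` {1..k})"

definition gk_ideal :: "nat \<Rightarrow> nat \<Rightarrow> gk_var qpoly set" where
  "gk_ideal k n = Idl\<^bsub>gk_poly_ring k n\<^esub> (gk_relations k n)"

definition QK_GK :: "nat \<Rightarrow> nat \<Rightarrow> gk_var qpoly set ring" where
  "QK_GK k n = gk_poly_ring k n Quot gk_ideal k n"

definition gk_class :: "nat \<Rightarrow> nat \<Rightarrow> gk_var qpoly \<Rightarrow> gk_var qpoly set" where
  "gk_class k n p = gk_ideal k n +>\<^bsub>gk_poly_ring k n\<^esub> p"


section \<open>The Coulomb branch ring\<close>

datatype coulomb_var = VarZ nat | VarZhat nat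

abbreviation z :: "nat \<Rightarrow> coulomb_var qpoly" where
  "z i \<equiv> var (VarZ i)"

abbreviation zhat :: "nat \<Rightarrow> coulomb_var qpoly" where
  "zhat i \<equiv> var (VarZhat i)"

definition c_ge :: "nat \<Rightarrow> nat \<Rightarrow> coulomb_var qpoly" where
  "c_ge k j = (\<Sum>i = j..k. (- 1) ^ (i - j) * elem_sym k z i)"

definition g_hat :: "nat \<Rightarrow> nat \<Rightarrow> nat \<Rightarrow> coulomb_var qpoly" where
  "g_hat k n l = c_ge k (l + 1) + (- 1) ^ (n + k) * q_elem * of_nat ((k - 1) choose (n - l))"

definition coulomb_relations :: "nat \<Rightarrow> nat \<Rightarrow> coulomb_var qpoly set" where
  "coulomb_relations k n =
     (\<lambda>l. (\<Sum>i = 0..l. elem_sym k z i * elem_sym (n - k) zhat (l - i)) - g_hat k n l) ` {1..n}"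

definition coulomb_poly_ring :: "nat \<Rightarrow> nat \<Rightarrow> coulomb_var qpoly ring" where
  "coulomb_poly_ring k n =
     adjoin (elem_sym k z ` {1..k} \<union> elem_sym (n - k) zhat ` {1..n - k})"

definition coulomb_ideal :: "nat \<Rightarrow> nat \<Rightarrow> coulomb_var qpoly set" where
  "coulomb_ideal k n = Idl\<^bsub>coulomb_poly_ring k n\<^esub> (coulomb_relations k n)"

definition QK_hat :: "nat \<Rightarrow> nat \<Rightarrow> coulomb_var qpoly set ring" where
  "QK_hat k n = coulomb_poly_ring k n Quot coulomb_ideal k n"

definition coulomb_class :: "nat \<Rightarrow> nat \<Rightarrow> coulomb_var qpoly \<Rightarrow> coulomb_var qpoly set" where
  "coulomb_class k n p = coulomb_ideal k n +>\<^bsub>coulomb_poly_ring k n\<^esub> p"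


section \<open>Algebra homomorphisms\<close>

text \<open>A homomorphism of commutative unital \<open>\<int>[[q]]\<close>-algebras is a ring homomorphism that
  commutes with the structure maps from \<open>\<int>[[q]]\<close>.\<close>

definition QK_alg_hom :: "nat \<Rightarrow> nat \<Rightarrow> (gk_var qpoly set \<Rightarrow> coulomb_var qpoly set) set" where
  "QK_alg_hom k n = {\<phi> \<in> ring_hom (QK_GK k n) (QK_hat k n).
     \<forall>c. \<phi> (gk_class k n (scalar c)) = coulomb_class k n (scalar c)}"

definition is_Xi :: "nat \<Rightarrow> nat \<Rightarrow> (gk_var qpoly set \<Rightarrow> coulomb_var qpoly set) \<Rightarrow> bool" where
  "is_Xi k n \<Xi> \<longleftrightarrow> \<Xi> \<in> QK_alg_hom k n \<and>
     (\<forall>j\<in>{1..n - k}. \<Xi> (gk_class k n (gk_H k n j)) = coulomb_class k n (groth_row k z j)) \<and>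
     (\<forall>j\<in>{1..k}. \<Xi> (gk_class k n (gk_E k j)) = coulomb_class k n (groth_col k z j))"

end

theory Submission
  imports Defs
begin

text \<open>
  Write \<open>m = n - k\<close>, \<open>e\<^sub>i\<close> for the elementary symmetric polynomials in the \<open>z\<close> and \<open>f\<^sub>j\<close> for those in
  the \<open>zhat\<close>. Both rings are quotients of polynomial rings in \<open>n\<close> generators, and already the
  polynomial rings are isomorphic, by \<open>H\<^sub>j \<mapsto> (-1)\<^sup>j f\<^sub>j\<close> and \<open>E\<^sub>j \<mapsto> G\<^bsub>1^j\<^esub>(z)\<close> (\<open>xi_lift\<close>). The theorem
  then rests on two facts about this map.

  \<^item> It carries the ideal of relations of the one ring onto that of the other. Under the
  substitution for the \<open>E\<^sub>j\<close>, the product \<open>(1 - \<xi>)\<^sup>k E(\<ominus>\<xi>)\<close> becomes \<open>\<Prod>\<^sub>i (z\<^sub>i - \<xi>)\<close>, so that the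
  Gorbounov-Korff relation times \<open>(1 - \<xi>)\<^sup>k\<close> becomes a polynomial in \<open>\<xi>\<close>, the \<open>gk_numerator\<close>. If
  \<open>R\<^sub>l\<close> is the \<open>l\<close>-th Coulomb branch relation and \<open>R\<^bsub>n+1\<^esub> = 0\<close>, then the coefficient of \<open>\<xi>\<^bsup>n-l\<^esup>\<close> in it
  is \<open>\<plusminus> (R\<^sub>l + R\<^bsub>l+1\<^esub>)\<close> (\<open>gk_numerator_eq\<close>). Starting from \<open>l = n\<close>, all \<open>R\<^sub>l\<close> are recovered from these
  coefficients, so both families have the same span.

  \<^item> The class of \<open>(-1)\<^sup>j f\<^sub>j\<close> is that of \<open>G\<^sub>j(z)\<close> for \<open>j \<le> m\<close>. In this range the relations do not
  involve \<open>q\<close> and determine the \<open>f\<^sub>j\<close> recursively from the \<open>e\<^sub>i\<close>, and the polynomials \<open>(-1)\<^sup>j G\<^sub>j\<close>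
  satisfy the same recursion (\<open>sum_elem_sym_groth_row0\<close>). The latter follows from
  \<open>G\<^sub>j - G\<^bsub>j+1\<^esub> = (\<Sum>\<^sub>i (-1)\<^sup>i e\<^sub>i) h\<^sub>j\<close>, which is a telescoping consequence of the Pieri rule
  \<open>h\<^sub>j e\<^sub>b = s\<^bsub>(j,1^b)\<^esub> + s\<^bsub>(j+1,1^(b-1))\<^esub>\<close> for hooks (\<open>complete_times_elem_sym\<close>, \<open>schur_hook\<close>).

  That \<open>xi_lift\<close> is injective amounts to the algebraic independence of the elementary symmetric
  polynomials. It is obtained from Vieta's formulas: over the algebraic closure of the field of
  fractions of the Gorbounov-Korff polynomial ring there are elements whose elementary symmetric
  polynomials take any prescribed values, and substituting these for the \<open>z\<close> and \<open>zhat\<close> undoes the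
  lift (\<open>exists_left_inverse_of_xi_lift\<close>).
\<close>

section \<open>Hook Schur polynomials\<close>

text \<open>
  A tableau of shape \<open>(j, 1\<^sup>b)\<close> is given by the multiset \<open>M\<close> of the entries of its first row and the
  set \<open>A\<close> of the entries below its corner. The corner is the least element of \<open>M\<close>, and it lies
  strictly below each \<open>a \<in> A\<close> iff some \<open>c \<in> M\<close> does. In this form the condition also makes sense for
  \<open>j = 0\<close>, where it forces \<open>A = {}\<close>.
\<close>

definition hook_pairs :: "nat \<Rightarrow> nat \<Rightarrow> nat \<Rightarrow> (nat multiset \<times> nat set) set" where
  "hook_pairs m j b = {(M, A). set_mset M \<subseteq> {1..m} \<and> size M = j \<and>
     A \<subseteq> {1..m} \<and> card A = b \<and> (\<forall>a\<in>A. \<exists>c\<in>#M. c < a)}"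

definition hook_sum :: "nat \<Rightarrow> (nat \<Rightarrow> 'a::comm_ring_1) \<Rightarrow> nat \<Rightarrow> nat \<Rightarrow> 'a" where
  "hook_sum m x j b = (\<Sum>(M, A)\<in>hook_pairs m j b. (\<Prod>a\<in>#M. x a) * (\<Prod>a\<in>A. x a))"

lemma finite_multisets_of_size: "finite {M. set_mset M \<subseteq> {1..m::nat} \<and> size M = j}"
proof -
  have "{M. set_mset M \<subseteq> {1..m} \<and> size M = j} \<subseteq> mset ` {xs. set xs \<subseteq> {1..m} \<and> length xs = j}"
    by (auto simp: image_iff) (metis ex_mset set_mset_mset size_mset)
  thus ?thesis
    by (rule finite_subset) (simp add: finite_lists_length_eq)
qed

lemma finite_subsets_of_card: "finite {A. A \<subseteq> {1..m::nat} \<and> card A = b}"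
  by (rule finite_subset[of _ "Pow {1..m}"]) auto

lemma hook_pairs_subset:
  "hook_pairs m j b \<subseteq> {M. set_mset M \<subseteq> {1..m} \<and> size M = j} \<times> {A. A \<subseteq> {1..m} \<and> card A = b}"
  by (auto simp: hook_pairs_def)

text \<open>
  The combinatorial content of the Pieri rule. If a pair \<open>(M, A)\<close> with \<open>A \<noteq> {}\<close> is not a hook, then
  \<open>Min A\<close> is at most every element of \<open>M\<close>; moved into \<open>M\<close>, it becomes the corner of a hook with a
  longer row. The inverse moves the corner of a hook into its column.
\<close>

lemma hook_pairs_Suc_bij:
  "bij_betw (\<lambda>(M, A). (M + {#Min A#}, A - {Min A}))
     ({M. set_mset M \<subseteq> {1..m} \<and> size M = j} \<times> {A. A \<subseteq> {1..m} \<and> card A = Suc b} - hook_pairs m j (Suc b))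
     (hook_pairs m (Suc j) b)"
proof (rule bij_betw_byWitness[where f' = "\<lambda>(M, A). (M - {#Min_mset M#}, insert (Min_mset M) A)"])
  have key: "finite A \<and> A \<noteq> {} \<and> (\<forall>c\<in>#M. Min A \<le> c)"
    if "(M, A) \<in> {M. set_mset M \<subseteq> {1..m} \<and> size M = j} \<times> {A. A \<subseteq> {1..m} \<and> card A = Suc b} - hook_pairs m j (Suc b)"
    for M A
  proof -
    have A: "A \<subseteq> {1..m}" "card A = Suc b" using that by auto
    hence fin: "finite A" using finite_subset by blast
    have ne: "A \<noteq> {}" using A by auto
    from that obtain a where a: "a \<in> A" "\<forall>c\<in>#M. a \<le> c"
      by (fastforce simp: hook_pairs_def not_less)
    have "Min A \<le> a" using fin a by simp
    hence "\<forall>c\<in>#M. Min A \<le> c" using a(2) by (meson order_trans)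
    thus ?thesis using fin ne by blast
  qed
  show "\<forall>p\<in>{M. set_mset M \<subseteq> {1..m} \<and> size M = j} \<times> {A. A \<subseteq> {1..m} \<and> card A = Suc b} - hook_pairs m j (Suc b).
    (\<lambda>(M, A). (M - {#Min_mset M#}, insert (Min_mset M) A)) ((\<lambda>(M, A). (M + {#Min A#}, A - {Min A})) p) = p"
  proof (clarify, goal_cases)
    case (1 M A)
    have k: "finite A" "A \<noteq> {}" "\<forall>c\<in>#M. Min A \<le> c" using key[of M A] 1 by auto
    have "Min (insert (Min A) (set_mset M)) = Min A"
      by (rule Min_eqI) (use k in auto)
    thus ?case using k by (simp add: insert_absorb)
  qed
  show "(\<lambda>(M, A). (M + {#Min A#}, A - {Min A})) `
     ({M. set_mset M \<subseteq> {1..m} \<and> size M = j} \<times> {A. A \<subseteq> {1..m} \<and> card A = Suc b} - hook_pairs m j (Suc b))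
     \<subseteq> hook_pairs m (Suc j) b"
  proof (clarify, goal_cases)
    case (1 _ _ M A)
    have k: "finite A" "A \<noteq> {}" "\<forall>c\<in>#M. Min A \<le> c" using key[of M A] 1 by auto
    have "Min A < a" if "a \<in> A" "a \<noteq> Min A" for a
      using k that by (simp add: order.strict_iff_order)
    moreover have "Min A \<in> A" using k by simp
    hence "Min A \<in> {1..m}" using 1 by auto
    ultimately show ?case using 1 k by (auto simp: hook_pairs_def)
  qed
  have key': "Min_mset M \<in># M \<and> finite A \<and> (\<forall>a\<in>A. Min_mset M < a) \<and> Min_mset M \<notin> A"
    if "(M, A) \<in> hook_pairs m (Suc j) b" for M A
  proof -
    have "M \<noteq> {#}" and sub: "A \<subseteq> {1..m}" and less: "\<forall>a\<in>A. \<exists>c\<in>#M. c < a"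
      using that by (auto simp: hook_pairs_def)
    hence "Min_mset M \<in># M" by (intro Min_in) auto
    moreover have "finite A" using sub by (rule finite_subset) simp
    moreover have "Min_mset M < a" if a: "a \<in> A" for a
    proof -
      obtain c where "c \<in># M" "c < a"
        using less a by blast
      thus ?thesis by (intro le_less_trans[OF Min_le]) auto
    qed
    ultimately show ?thesis by auto
  qed
  show "\<forall>p\<in>hook_pairs m (Suc j) b. (\<lambda>(M, A). (M + {#Min A#}, A - {Min A}))
     ((\<lambda>(M, A). (M - {#Min_mset M#}, insert (Min_mset M) A)) p) = p"
  proof (clarify, goal_cases)
    case (1 M A)
    have k: "Min_mset M \<in># M" "finite A" "\<forall>a\<in>A. Min_mset M < a" "Min_mset M \<notin> A" using key'[OF 1] by auto
    have "Min (insert (Min_mset M) A) = Min_mset M"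
      by (rule Min_eqI) (use k in auto)
    thus ?case using k by simp
  qed
  show "(\<lambda>(M, A). (M - {#Min_mset M#}, insert (Min_mset M) A)) ` hook_pairs m (Suc j) b \<subseteq>
     {M. set_mset M \<subseteq> {1..m} \<and> size M = j} \<times> {A. A \<subseteq> {1..m} \<and> card A = Suc b} - hook_pairs m j (Suc b)"
  proof (clarify, goal_cases)
    case (1 _ _ M A)
    have k: "Min_mset M \<in># M" "finite A" "\<forall>a\<in>A. Min_mset M < a" "Min_mset M \<notin> A" using key'[OF 1] by auto
    have "\<not> c < Min_mset M" if "c \<in># M" for c using that by (simp add: not_less)
    hence "\<not> c < Min_mset M" if "c \<in># M - {#Min_mset M#}" for c using that by (meson in_diffD)
    hence "(M - {#Min_mset M#}, insert (Min_mset M) A) \<notin> hook_pairs m j (Suc b)"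
      by (auto simp: hook_pairs_def)
    moreover have "set_mset (M - {#Min_mset M#}) \<subseteq> {1..m}"
      using 1 by (auto simp: hook_pairs_def dest: in_diffD)
    moreover have "set_mset M \<subseteq> {1..m}" using 1 by (simp add: hook_pairs_def)
    hence "Min_mset M \<in> {1..m}" using k(1) by (rule subsetD)
    ultimately show ?case using k 1 by (auto simp: hook_pairs_def size_Diff_singleton)
  qed
qed

text \<open>
  The Pieri rule for hooks. The products of a monomial of \<open>h\<^sub>j\<close> and one of \<open>e\<^bsub>b+1\<^esub>\<close> are indexed by all
  pairs \<open>(M, A)\<close>; those that are hooks give the first summand and the others, by
  \<open>hook_pairs_Suc_bij\<close>, the second. For \<open>j = 0\<close> it identifies the one-column hook with \<open>e\<^bsub>b+1\<^esub>\<close>.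
\<close>

lemma complete_times_elem_sym:
  "complete_sym m x j * elem_sym m x (Suc b) = hook_sum m x j (Suc b) + hook_sum m x (Suc j) b"
proof -
  let ?D = "{M. set_mset M \<subseteq> {1..m} \<and> size M = j} \<times> {A. A \<subseteq> {1..m} \<and> card A = Suc b}"
  let ?w = "\<lambda>(M, A). (\<Prod>a\<in>#M. x a) * (\<Prod>a\<in>A. x a)"
  have "complete_sym m x j * elem_sym m x (Suc b) = sum ?w ?D"
    by (simp add: complete_sym_def elem_sym_def sum_product sum.cartesian_product)
  also have "\<dots> = sum ?w (?D - hook_pairs m j (Suc b)) + sum ?w (hook_pairs m j (Suc b))"
    by (rule sum.subset_diff[OF hook_pairs_subset])
       (intro finite_cartesian_product finite_multisets_of_size finite_subsets_of_card)
  also have "sum ?w (?D - hook_pairs m j (Suc b)) = sum ?w (hook_pairs m (Suc j) b)"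
  proof (subst sum.reindex_bij_betw[OF hook_pairs_Suc_bij, symmetric], rule sum.cong[OF refl], clarify, goal_cases)
    case (1 M A)
    have "finite A" "A \<noteq> {}" using 1 by (auto intro: finite_subset)
    hence "(\<Prod>a\<in>A. x a) = x (Min A) * (\<Prod>a\<in>A - {Min A}. x a)"
      by (intro prod.remove) auto
    thus ?case by (simp add: algebra_simps)
  qed
  finally show ?thesis by (simp add: hook_sum_def)
qed

lemma hook_sum_0_right: "hook_sum m x j 0 = complete_sym m x j"
proof -
  have "hook_pairs m j 0 = (\<lambda>M. (M, {})) ` {M. set_mset M \<subseteq> {1..m} \<and> size M = j}"
    by (auto simp: hook_pairs_def dest: finite_subset[OF _ finite_atLeastAtMost])
  thus ?thesis
    by (simp add: hook_sum_def complete_sym_def sum.reindex inj_on_def)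
qed

lemma hook_sum_0_left: "b > 0 \<Longrightarrow> hook_sum m x 0 b = 0"
  by (auto simp: hook_sum_def hook_pairs_def intro!: sum.neutral)

text \<open>
  The entries below the corner differ from \<open>1\<close>, so there are fewer than \<open>m\<close> of them.
\<close>

lemma hook_sum_eq_0:
  assumes "0 < m" "m \<le> b" shows "hook_sum m x j b = 0"
proof -
  have "hook_pairs m j b = {}"
  proof (clarsimp simp: hook_pairs_def set_eq_iff)
    fix M A assume *: "set_mset M \<subseteq> {Suc 0..m}" "A \<subseteq> {Suc 0..m}" "b = card A"
    hence "A = {1..m}" using assms card_seteq[of "{1..m}" A] by auto
    hence "1 \<in> A" using assms by auto
    thus "\<exists>a\<in>A. \<forall>c\<in>#M. \<not> c < a" using * by force
  qed
  thus ?thesis by (simp add: hook_sum_def)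
qed

lemma complete_sym_0 [simp]: "complete_sym m x 0 = 1"
proof -
  have "{M. set_mset M \<subseteq> {1..m} \<and> size M = 0} = {{#}}" by auto
  thus ?thesis by (simp add: complete_sym_def)
qed

lemma elem_sym_0 [simp]: "elem_sym m x 0 = 1"
proof -
  have "{A. A \<subseteq> {1..m} \<and> card A = 0} = {{}}" by (auto dest: finite_subset)
  thus ?thesis by (simp add: elem_sym_def)
qed

lemma elem_sym_eq_0:
  assumes "m < i" shows "elem_sym m x i = 0"
proof -
  have "card A \<noteq> i" if "A \<subseteq> {1..m}" for A
    using card_mono[OF finite_atLeastAtMost that] assms by simp
  thus ?thesis by (simp add: elem_sym_def cong: conj_cong)
qed

lemma sum_alternating_telescope:
  fixes t :: "nat \<Rightarrow> 'a::comm_ring_1"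
  shows "(\<Sum>i<l. (- 1) ^ Suc i * (t (Suc i) + t i)) = (- 1) ^ l * t l - t 0"
  by (induction l) (auto simp: algebra_simps)

text \<open>
  The power series \<open>\<Sum> (-1)\<^sup>i e\<^sub>i t\<^sup>i\<close> and \<open>\<Sum> h\<^sub>i t\<^sup>i\<close> are inverse to each other. By the Pieri rule each
  product of \<open>e\<^sub>i\<close> and \<open>h\<^bsub>l-i\<^esub>\<close> is a sum of two neighbours in a sequence of hooks, and the
  alternating sum telescopes.
\<close>

lemma sum_elem_complete_sym:
  assumes "0 < l"
  shows "(\<Sum>i\<le>l. (- 1) ^ i * elem_sym m x i * complete_sym m x (l - i)) = 0"
proof -
  have "(\<Sum>i\<le>l. (- 1) ^ i * elem_sym m x i * complete_sym m x (l - i)) =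
    complete_sym m x l + (\<Sum>i<l. (- 1) ^ Suc i * (complete_sym m x (l - Suc i) * elem_sym m x (Suc i)))"
    by (subst sum.atMost_shift) (simp add: mult_ac)
  also have "(\<Sum>i<l. (- 1) ^ Suc i * (complete_sym m x (l - Suc i) * elem_sym m x (Suc i))) =
     (\<Sum>i<l. (- 1) ^ Suc i * (hook_sum m x (l - Suc i) (Suc i) + hook_sum m x (l - i) i))"
    by (intro sum.cong refl) (simp add: complete_times_elem_sym Suc_diff_Suc)
  also have "\<dots> = - complete_sym m x l"
    using assms by (subst sum_alternating_telescope[of "\<lambda>i. hook_sum m x (l - i) i"])
      (simp add: hook_sum_0_left hook_sum_0_right)
  finally show ?thesis by simp
qed

lemma diagram_hook:
  assumes "0 < j"
  shows "diagram (j # replicate b 1) = Pair 0 ` {..<j} \<union> (\<lambda>s. (s, 0)) ` {1..b}"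
  using assms by (auto simp: diagram_def nth_Cons image_iff split: nat.splits)

text \<open>
  Rows of tableaux weakly increase and columns strictly increase, so the row is recovered from its
  multiset of entries and the column from its set of entries by sorting.
\<close>

lemma hook_ssyt_bij:
  assumes j: "0 < j"
  shows "bij_betw (\<lambda>T. (mset (map (\<lambda>t. T (0, t)) [0..<j]), (\<lambda>s. T (s, 0)) ` {1..b}))
    (ssyt m (j # replicate b 1)) (hook_pairs m j b)"
proof (rule bij_betw_byWitness[where f' = "\<lambda>(M, A). restrict (\<lambda>(s, t).
      if s = 0 then sorted_list_of_multiset M ! t else sorted_list_of_set A ! (s - 1)) (diagram (j # replicate b 1))"])
  let ?D = "diagram (j # replicate b 1)"
  let ?f = "\<lambda>T. (mset (map (\<lambda>t. T (0, t)) [0..<j]), (\<lambda>s. T (s, 0)) ` {1..b})"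
  let ?g = "\<lambda>(M, A). restrict (\<lambda>(s, t).
      if s = 0 then sorted_list_of_multiset M ! t else sorted_list_of_set A ! (s - 1)) ?D"
  have D: "(s, t) \<in> ?D \<longleftrightarrow> (s = 0 \<and> t < j) \<or> (t = 0 \<and> 1 \<le> s \<and> s \<le> b)" for s t
    unfolding diagram_hook[OF j] by auto
  note D = D D[unfolded One_nat_def]
  have row: "sorted (map (\<lambda>t. T (0, t)) [0..<j])"
    if T: "T \<in> ssyt m (j # replicate b 1)" for T
  proof -
    have "T (0, t) \<le> T (0, Suc t)" if "Suc t < j" for t
    proof -
      have "(0, Suc t) \<in> ?D" using that by (simp add: D)
      thus ?thesis using T by (simp add: ssyt_def)
    qed
    thus ?thesis by (simp add: sorted_iff_nth_Suc)
  qed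
  have col: "T (s, 0) < T (s', 0)"
    if T: "T \<in> ssyt m (j # replicate b 1)" and "s < s'" "s' \<le> b" for T s s'
    using that(2,3)
  proof (induction s' rule: nat_induct)
    case (Suc r)
    have "(Suc r, 0) \<in> ?D" using Suc.prems by (simp add: D)
    hence "T (r, 0) < T (Suc r, 0)" using T by (simp add: ssyt_def)
    with Suc show ?case by (cases "s = r") auto
  qed simp
  have inj: "inj_on (\<lambda>s. T (s, 0)) {1..b}" if T: "T \<in> ssyt m (j # replicate b 1)" for T
    using col[OF T] by (intro strict_mono_on_imp_inj_on) (auto intro!: strict_mono_onI)
  have col_list: "sorted_list_of_set ((\<lambda>s. T (s, 0)) ` {1..b}) = map (\<lambda>s. T (s, 0)) [1..<Suc b]"
    if T: "T \<in> ssyt m (j # replicate b 1)" for T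
  proof -
    have "sorted_wrt (<) (map (\<lambda>s. T (s, 0)) [1..<Suc b])"
      unfolding sorted_wrt_map
      by (rule sorted_wrt_mono_rel[OF _ sorted_wrt_upt]) (use col[OF T] in auto)
    moreover have "set (map (\<lambda>s. T (s, 0)) [1..<Suc b]) = (\<lambda>s. T (s, 0)) ` {1..b}"
      by (simp add: atLeastLessThanSuc_atLeastAtMost del: upt_Suc)
    ultimately show ?thesis
      by (metis sorted_list_of_set.idem_if_sorted_distinct strict_sorted_iff)
  qed
  have vals: "T (s, t) \<in> {1..m}" if "T \<in> ssyt m (j # replicate b 1)" "(s, t) \<in> ?D" for T s t
    using that unfolding ssyt_def by blast
  show "\<forall>T\<in>ssyt m (j # replicate b 1). ?g (?f T) = T"
  proof
    fix T assume T: "T \<in> ssyt m (j # replicate b 1)"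
    show "?g (?f T) = T"
    proof (rule extensionalityI[of _ ?D])
      show "?g (?f T) \<in> extensional ?D" by simp
      show "T \<in> extensional ?D" using T by (auto simp: ssyt_def PiE_def)
      fix p assume "p \<in> ?D"
      moreover obtain s t where p: "p = (s, t)" by (cases p)
      ultimately have st: "(s, t) \<in> ?D" by simp
      show "?g (?f T) p = T p"
      proof (cases "s = 0")
        case True
        with st have "t < j" by (simp add: D)
        thus ?thesis using True st row[OF T] p
          by (simp add: sorted_sort_id del: mset_map)
      next
        case False
        with st have "t = 0" "s - 1 < b" "1 \<le> s" by (auto simp: D)
        thus ?thesis using False st p
          by (simp add: col_list[OF T, unfolded One_nat_def] del: upt_Suc)
      qed
    qed
  qed
  show "?f ` ssyt m (j # replicate b 1) \<subseteq> hook_pairs m j b"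
  proof
    fix p assume "p \<in> ?f ` ssyt m (j # replicate b 1)"
    then obtain T where T: "T \<in> ssyt m (j # replicate b 1)" and p: "p = ?f T" by blast
    have "T (0, 0) \<in># mset (map (\<lambda>t. T (0, t)) [0..<j])" using j by auto
    moreover have "T (0, 0) < T (s, 0)" if "s \<in> {1..b}" for s
      using that by (intro col[OF T]) auto
    ultimately have "\<forall>a\<in>(\<lambda>s. T (s, 0)) ` {1..b}. \<exists>c\<in>#mset (map (\<lambda>t. T (0, t)) [0..<j]). c < a"
      by blast
    moreover have "T (0, t) \<in> {1..m}" if "t < j" for t using that by (intro vals[OF T]) (simp add: D)
    hence "set_mset (mset (map (\<lambda>t. T (0, t)) [0..<j])) \<subseteq> {1..m}" by auto
    moreover have "T (s, 0) \<in> {1..m}" if "s \<in> {1..b}" for s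
      using that by (intro vals[OF T]) (simp add: D)
    hence "(\<lambda>s. T (s, 0)) ` {1..b} \<subseteq> {1..m}" by blast
    moreover have "card ((\<lambda>s. T (s, 0)) ` {1..b}) = b" using inj[OF T] by (simp add: card_image)
    ultimately show "p \<in> hook_pairs m j b" unfolding p hook_pairs_def by simp
  qed
  have MA: "length (sorted_list_of_multiset M) = j" "length (sorted_list_of_set A) = b"
      "set (sorted_list_of_set A) = A" "A \<subseteq> {1..m}" "set_mset M \<subseteq> {1..m}"
      "\<forall>a\<in>A. \<exists>c\<in>#M. c < a" if MA: "(M, A) \<in> hook_pairs m j b" for M A
  proof -
    show A: "A \<subseteq> {1..m}" using MA by (simp add: hook_pairs_def)
    hence "finite A" by (rule finite_subset) simp
    thus "length (sorted_list_of_set A) = b" "set (sorted_list_of_set A) = A"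
      using MA by (simp_all add: hook_pairs_def)
    show "set_mset M \<subseteq> {1..m}" "\<forall>a\<in>A. \<exists>c\<in>#M. c < a"
      using MA by (simp_all add: hook_pairs_def)
    have "size (mset (sorted_list_of_multiset M)) = j"
      using MA by (simp add: hook_pairs_def)
    thus "length (sorted_list_of_multiset M) = j" by (simp only: size_mset)
  qed
  show "\<forall>p\<in>hook_pairs m j b. ?f (?g p) = p"
  proof
    fix p assume p: "p \<in> hook_pairs m j b"
    obtain M A where pMA: "p = (M, A)" by (cases p)
    note MA = MA[OF p[unfolded pMA]]
    have "map (\<lambda>t. ?g p (0, t)) [0..<j] = map (\<lambda>t. sorted_list_of_multiset M ! t) [0..<j]"
      unfolding pMA by (intro map_cong refl) (simp add: D)
    also have "\<dots> = sorted_list_of_multiset M" using MA(1) map_nth by blast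
    finally have 1: "mset (map (\<lambda>t. ?g p (0, t)) [0..<j]) = M" by simp
    have "(\<lambda>s. ?g p (s, 0)) ` {1..b} = (\<lambda>s. sorted_list_of_set A ! (s - 1)) ` {1..b}"
      unfolding pMA by (intro image_cong refl) (simp add: D)
    also have "\<dots> = (!) (sorted_list_of_set A) ` {..<b}"
      unfolding image_image[symmetric, of "(!) (sorted_list_of_set A)" "\<lambda>s. s - 1"]
      by (intro arg_cong[where f = "image _"]) (auto simp: image_iff intro!: bexI[of _ "Suc _"])
    also have "\<dots> = A" 
    proof -
      have "(!) (sorted_list_of_set A) ` {..<b} = set (map ((!) (sorted_list_of_set A)) [0..<b])"
        by (simp add: lessThan_atLeast0)
      also have "\<dots> = A" using MA(2,3) map_nth by metis
      finally show ?thesis .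
    qed
    finally show "?f (?g p) = p" using 1 pMA by simp
  qed
  show "?g ` hook_pairs m j b \<subseteq> ssyt m (j # replicate b 1)"
  proof
    fix T assume "T \<in> ?g ` hook_pairs m j b"
    then obtain M A where hp: "(M, A) \<in> hook_pairs m j b" and T: "T = ?g (M, A)" by auto
    note MA = MA[OF hp]
    have T0: "T (0, t) = sorted_list_of_multiset M ! t" if "t < j" for t
      using that by (simp add: T D)
    have T1: "T (s, 0) = sorted_list_of_set A ! (s - 1)" if "1 \<le> s" "s \<le> b" for s
      using that by (simp add: T D)
    have T0': "T (0, t) \<in># M" if "t < j" for t
      using T0[OF that] MA(1) that nth_mem[of t "sorted_list_of_multiset M"] by simp
    have T1': "T (s, 0) \<in> A" if "1 \<le> s" "s \<le> b" for s
      using T1[OF that] MA(2,3) that nth_mem[of "s - 1" "sorted_list_of_set A"] by simp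
    have "T \<in> ?D \<rightarrow>\<^sub>E {1..m}"
    proof (rule PiE_I)
      fix p assume "p \<in> ?D"
      thus "T p \<in> {1..m}" using T0' T1' MA(4,5) by (cases p) (auto simp: D subset_iff)
    qed (simp add: T)
    moreover have "T (s, t) \<le> T (s, Suc t)" if "(s, Suc t) \<in> ?D" for s t
      using that MA(1) by (auto simp: D T0 intro!: sorted_nth_mono)
    moreover have "T (s, t) < T (Suc s, t)" if "(Suc s, t) \<in> ?D" for s t
    proof -
      have st: "t = 0" "s < b" using that by (auto simp: D)
      show ?thesis
      proof (cases "s = 0")
        case True
        obtain c where c: "c \<in># M" "c < T (1, 0)" using T1'[of 1] MA(6) st by auto
        then obtain i where "i < j" "c = sorted_list_of_multiset M ! i"
          using MA(1) by (metis in_set_conv_nth set_sorted_list_of_multiset)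
        hence "T (0, 0) \<le> c" using MA(1) T0[OF j] by (auto intro!: sorted_nth_mono)
        thus ?thesis using c True st by simp
      next
        case False
        thus ?thesis using st MA(2) T1[of s] T1[of "Suc s"]
          by (simp add: sorted_wrt_nth_less[OF strict_sorted_list_of_set])
      qed
    qed
    ultimately show "T \<in> ssyt m (j # replicate b 1)" unfolding ssyt_def by blast
  qed
qed

lemma schur_hook:
  assumes j: "0 < j"
  shows "schur m x (j # replicate b 1) = hook_sum m x j b"
  unfolding schur_def hook_sum_def
proof (subst sum.reindex_bij_betw[OF hook_ssyt_bij[OF j], symmetric], rule sum.cong[OF refl], goal_cases)
  case (1 T)
  have "card ((\<lambda>s. T (s, 0)) ` {1..b}) = b"
    using bij_betw_apply[OF hook_ssyt_bij[OF j] 1] by (simp add: hook_pairs_def)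
  hence inj: "inj_on (\<lambda>s. T (s, 0)) {1..b}" by (intro eq_card_imp_inj_on) auto
  have "(\<Prod>c\<in>diagram (j # replicate b 1). x (T c)) =
     (\<Prod>c\<in>Pair 0 ` {..<j}. x (T c)) * (\<Prod>c\<in>(\<lambda>s. (s, 0)) ` {1..b}. x (T c))"
    unfolding diagram_hook[OF j] by (rule prod.union_disjoint) auto
  also have "(\<Prod>c\<in>Pair 0 ` {..<j}. x (T c)) = (\<Prod>t<j. x (T (0, t)))"
    by (subst prod.reindex) (auto simp: inj_on_def)
  also have "\<dots> = (\<Prod>a\<in>#mset (map (\<lambda>t. T (0, t)) [0..<j]). x a)"
    by (simp add: prod_unfold_prod_mset lessThan_atLeast0 image_mset.compositionality o_def)
  also have "(\<Prod>c\<in>(\<lambda>s. (s, 0)) ` {1..b}. x (T c)) = (\<Prod>s\<in>{1..b}. x (T (s, 0)))"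
    by (subst prod.reindex) (auto simp: inj_on_def)
  also have "\<dots> = (\<Prod>a\<in>(\<lambda>s. T (s, 0)) ` {1..b}. x a)"
    using inj by (simp add: prod.reindex)
  finally show ?case by simp
qed

section \<open>Grothendieck polynomials of one row and one column\<close>

text \<open>
  The polynomial \<open>c\<^sup>z\<^bsub>\<ge>j\<^esub>\<close>, with the variables replaced by arbitrary ring elements.
\<close>

definition alternating_tail :: "nat \<Rightarrow> (nat \<Rightarrow> 'a::comm_ring_1) \<Rightarrow> nat \<Rightarrow> 'a" where
  "alternating_tail k x j = (\<Sum>i = j..k. (- 1) ^ (i - j) * elem_sym k x i)"

lemma alternating_tail_Suc: "alternating_tail k x j = elem_sym k x j - alternating_tail k x (Suc j)"
proof (cases "j \<le> k")
  case True
  have "(\<Sum>i = Suc j..k. (- 1) ^ (i - j) * elem_sym k x i) =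
     (\<Sum>i = Suc j..k. - ((- 1) ^ (i - Suc j) * elem_sym k x i))"
  proof (intro sum.cong refl)
    fix i assume "i \<in> {Suc j..k}"
    hence "i - j = Suc (i - Suc j)" by auto
    thus "(- 1) ^ (i - j) * elem_sym k x i = - ((- 1) ^ (i - Suc j) * elem_sym k x i)" by simp
  qed
  with True show ?thesis
    by (simp add: alternating_tail_def sum.atLeast_Suc_atMost[of j] sum_negf)
qed (simp add: alternating_tail_def elem_sym_eq_0)

text \<open>
  The defining formula of \<open>G\<^sub>j\<close> is not meant for \<open>j = 0\<close>. With the value \<open>G\<^sub>0 = 1\<close>, the formula for
  \<open>G\<^sub>j - G\<^bsub>j+1\<^esub>\<close> holds from \<open>j = 0\<close> on.
\<close>

definition groth_row0 :: "nat \<Rightarrow> (nat \<Rightarrow> 'a::comm_ring_1) \<Rightarrow> nat \<Rightarrow> 'a" where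
  "groth_row0 k x j = (if j = 0 then 1 else groth_row k x j)"

lemma groth_row0_eq_hook_sum:
  assumes "0 < k"
  shows "groth_row0 k x j = (\<Sum>b\<le>k. (- 1) ^ b * hook_sum k x j b)"
proof (cases "j = 0")
  case True
  have "(\<Sum>b\<le>k. (- 1) ^ b * hook_sum k x 0 b) = (\<Sum>b\<in>{0}. (- 1) ^ b * hook_sum k x 0 b)"
    by (intro sum.mono_neutral_right) (auto simp: hook_sum_0_left)
  thus ?thesis using True by (simp add: groth_row0_def hook_sum_0_right)
next
  case False
  have "(\<Sum>a = 2..k. (- 1) ^ a * schur k x (j # replicate (a - 1) 1)) =
      (\<Sum>a = Suc 1..Suc (k - 1). (- 1) ^ a * hook_sum k x j (a - 1))"
    using assms False by (intro sum.cong) (auto simp: schur_hook[unfolded One_nat_def])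
  also have "\<dots> = (\<Sum>b = 1..k - 1. - ((- 1) ^ b * hook_sum k x j b))"
    unfolding sum.shift_bounds_cl_Suc_ivl by simp
  finally have "(\<Sum>a = 2..k. (- 1) ^ a * schur k x (j # replicate (a - 1) 1)) =
      (\<Sum>b = 1..k - 1. - ((- 1) ^ b * hook_sum k x j b))" .
  hence "groth_row0 k x j = hook_sum k x j 0 + (\<Sum>b = 1..k - 1. (- 1) ^ b * hook_sum k x j b)"
    using False by (simp add: groth_row0_def groth_row_def hook_sum_0_right sum_negf)
  also have "\<dots> = (\<Sum>b = 0..k - 1. (- 1) ^ b * hook_sum k x j b)"
    by (subst (2) sum.atLeast_Suc_atMost) auto
  also have "\<dots> = (\<Sum>b\<le>k. (- 1) ^ b * hook_sum k x j b)"
    using assms by (cases k) (auto simp: hook_sum_eq_0 atLeast0AtMost)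
  finally show ?thesis .
qed

text \<open>
  Both sides are alternating sums over hooks. Pairing the hook \<open>(j, 1\<^bsup>b+1\<^esup>)\<close> of \<open>G\<^sub>j\<close> with the hook
  \<open>(j + 1, 1\<^sup>b)\<close> of \<open>G\<^bsub>j+1\<^esub>\<close>, which occurs with the same sign in the difference, produces \<open>h\<^sub>j e\<^bsub>b+1\<^esub>\<close>.
\<close>

lemma groth_row0_diff:
  assumes "0 < k"
  shows "groth_row0 k x j - groth_row0 k x (Suc j) = alternating_tail k x 0 * complete_sym k x j"
proof -
  have "groth_row0 k x (Suc j) = (\<Sum>b<k. (- 1) ^ b * hook_sum k x (Suc j) b)"
    using assms by (simp add: groth_row0_eq_hook_sum hook_sum_eq_0 flip: lessThan_Suc_atMost)
  moreover have "groth_row0 k x j = hook_sum k x j 0 + (\<Sum>b<k. (- 1) ^ Suc b * hook_sum k x j (Suc b))"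
    unfolding groth_row0_eq_hook_sum[OF assms] by (subst sum.atMost_shift) simp
  ultimately have "groth_row0 k x j - groth_row0 k x (Suc j) =
      complete_sym k x j + (\<Sum>b<k. (- 1) ^ Suc b * (hook_sum k x j (Suc b) + hook_sum k x (Suc j) b))"
    by (simp add: hook_sum_0_right distrib_left sum.distrib sum_negf sum_subtractf)
  also have "\<dots> = (\<Sum>b\<le>k. (- 1) ^ b * (complete_sym k x j * elem_sym k x b))"
    by (subst sum.atMost_shift) (simp add: complete_times_elem_sym)
  also have "\<dots> = alternating_tail k x 0 * complete_sym k x j"
    by (simp add: alternating_tail_def sum_distrib_left mult_ac atLeast0AtMost)
  finally show ?thesis .
qed

text \<open>
  This is the Coulomb branch relation of degree \<open>l\<close> without its \<open>q\<close>-term, with \<open>(-1)\<^sup>j G\<^sub>j\<close> in place of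
  \<open>e\<^sub>j(zhat)\<close>. Adding the left-hand sides for \<open>l\<close> and \<open>l + 1\<close> turns the \<open>G\<^sub>j\<close> into the differences
  \<open>G\<^sub>j - G\<^bsub>j+1\<^esub>\<close>, hence into multiples of \<open>h\<^sub>j\<close>, whose alternating convolution with the \<open>e\<^sub>i\<close> vanishes in
  positive degree.
\<close>

lemma sum_elem_sym_groth_row0:
  assumes k: "0 < k" and "0 < l"
  shows "(\<Sum>i\<le>l. elem_sym k x i * ((- 1) ^ (l - i) * groth_row0 k x (l - i))) = alternating_tail k x (Suc l)"
proof -
  define T where "T = (\<lambda>l. \<Sum>i\<le>l. elem_sym k x i * ((- 1) ^ (l - i) * groth_row0 k x (l - i)))"
  have step: "T l + T (Suc l) = elem_sym k x (Suc l) + (if l = 0 then alternating_tail k x 0 else 0)" for l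
  proof -
    have "T l + T (Suc l) = (\<Sum>i\<le>l. elem_sym k x i * ((- 1) ^ (l - i) * groth_row0 k x (l - i)) +
        elem_sym k x i * ((- 1) ^ (Suc l - i) * groth_row0 k x (Suc l - i))) + elem_sym k x (Suc l)"
      unfolding T_def by (simp add: sum.distrib groth_row0_def)
    also have "(\<Sum>i\<le>l. elem_sym k x i * ((- 1) ^ (l - i) * groth_row0 k x (l - i)) +
        elem_sym k x i * ((- 1) ^ (Suc l - i) * groth_row0 k x (Suc l - i))) =
      (\<Sum>i\<le>l. elem_sym k x i * ((- 1) ^ (l - i) * (groth_row0 k x (l - i) - groth_row0 k x (Suc (l - i)))))"
      by (intro sum.cong refl) (simp add: Suc_diff_le algebra_simps)
    also have "\<dots> = (\<Sum>i\<le>l. (-1) ^ l * alternating_tail k x 0 *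
        ((- 1) ^ i * elem_sym k x i * complete_sym k x (l - i)))"
    proof (intro sum.cong refl)
      fix i assume "i \<in> {..l}"
      hence "(-1 :: 'a) ^ (l - i) = (-1) ^ l * (-1) ^ i"
        by (auto simp: power_diff_conv_inverse minus_one_power_iff)
      thus "elem_sym k x i * ((- 1) ^ (l - i) * (groth_row0 k x (l - i) - groth_row0 k x (Suc (l - i)))) =
         (-1) ^ l * alternating_tail k x 0 * ((- 1) ^ i * elem_sym k x i * complete_sym k x (l - i))"
        by (simp add: groth_row0_diff[OF k] mult_ac)
    qed
    also have "\<dots> = (if l = 0 then alternating_tail k x 0 else 0)"
      by (auto simp: sum_elem_complete_sym simp flip: sum_distrib_left)
    finally show ?thesis by simp
  qed
  have "T (Suc l) = alternating_tail k x (Suc (Suc l))" for l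
  proof (induction l)
    case 0
    have "T 0 = 1" by (simp add: T_def groth_row0_def)
    with step[of 0] alternating_tail_Suc[of k x 0] alternating_tail_Suc[of k x 1]
    have "T (Suc 0) + alternating_tail k x (Suc 0) =
        alternating_tail k x (Suc (Suc 0)) + alternating_tail k x (Suc 0)"
      by (simp add: algebra_simps)
    thus ?case by simp
  next
    case (Suc l)
    with step[of "Suc l"] alternating_tail_Suc[of k x "Suc (Suc l)"]
    show ?case by (simp add: algebra_simps)
  qed
  from this[of "l - 1"] show ?thesis using \<open>0 < l\<close> by (simp add: T_def)
qed

section \<open>Evaluation homomorphisms\<close>

locale unital_hom =
  fixes h :: "'a::comm_ring_1 \<Rightarrow> 'b::comm_ring_1"
  assumes hom_add: "h (a + b) = h a + h b"
    and hom_mult: "h (a * b) = h a * h b"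
    and hom_one: "h 1 = 1"
begin

lemma hom_zero: "h 0 = 0"
  using hom_add[of 0 0] by simp

lemma hom_uminus: "h (- a) = - h a"
  using hom_add[of a "- a"] by (simp add: hom_zero eq_neg_iff_add_eq_0 add.commute)

lemma hom_diff: "h (a - b) = h a - h b"
  using hom_add[of a "- b"] by (simp add: hom_uminus)

lemma hom_power: "h (a ^ r) = h a ^ r"
  by (induction r) (simp_all add: hom_one hom_mult)

lemma hom_of_nat: "h (of_nat r) = of_nat r"
  by (induction r) (simp_all add: hom_zero hom_one hom_add)

lemma hom_sum: "h (sum f A) = (\<Sum>a\<in>A. h (f a))"
  by (induction A rule: infinite_finite_induct) (simp_all add: hom_zero hom_add)

lemma hom_prod: "h (prod f A) = (\<Prod>a\<in>A. h (f a))"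
  by (induction A rule: infinite_finite_induct) (simp_all add: hom_one hom_mult)

lemmas hom_simps = hom_zero hom_one hom_add hom_mult hom_uminus hom_diff hom_power hom_of_nat
  hom_sum hom_prod

lemma hom_elem_sym: "h (elem_sym m x i) = elem_sym m (\<lambda>a. h (x a)) i"
  by (simp add: elem_sym_def hom_simps)

lemma hom_groth_col: "h (groth_col m x i) = groth_col m (\<lambda>a. h (x a)) i"
  by (simp add: groth_col_def hom_simps hom_elem_sym)

end

definition eval_qpoly :: "(int fps \<Rightarrow> 'b::comm_ring_1) \<Rightarrow> ('v \<Rightarrow> 'b) \<Rightarrow> 'v qpoly \<Rightarrow> 'b" where
  "eval_qpoly c f p = (\<Sum>m\<in>Poly_Mapping.keys p. c (Poly_Mapping.lookup p m) *
     (\<Prod>v\<in>Poly_Mapping.keys m. f v ^ Poly_Mapping.lookup m v))"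

locale qpoly_evaluation = unital_hom c for c :: "int fps \<Rightarrow> 'b::comm_ring_1" +
  fixes f :: "'v \<Rightarrow> 'b"
begin

definition monom_value :: "('v \<Rightarrow>\<^sub>0 nat) \<Rightarrow> 'b" where
  "monom_value m = (\<Prod>v\<in>Poly_Mapping.keys m. f v ^ Poly_Mapping.lookup m v)"

lemma monom_value_superset:
  assumes "finite V" "Poly_Mapping.keys m \<subseteq> V"
  shows "monom_value m = (\<Prod>v\<in>V. f v ^ Poly_Mapping.lookup m v)"
  unfolding monom_value_def using assms
  by (intro prod.mono_neutral_left) (auto simp: in_keys_iff)

lemma monom_value_add: "monom_value (m + m') = monom_value m * monom_value m'"
proof -
  let ?V = "Poly_Mapping.keys m \<union> Poly_Mapping.keys m'"
  have "Poly_Mapping.keys (m + m') \<subseteq> ?V" by (rule Poly_Mapping.keys_add)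
  thus ?thesis
    by (simp add: monom_value_superset[of ?V] lookup_add power_add prod.distrib)
qed

lemma eval_superset:
  assumes "finite K" "Poly_Mapping.keys p \<subseteq> K"
  shows "eval_qpoly c f p = (\<Sum>m\<in>K. c (Poly_Mapping.lookup p m) * monom_value m)"
  unfolding eval_qpoly_def monom_value_def using assms
  by (intro sum.mono_neutral_left) (auto simp: in_keys_iff hom_zero)

lemma eval_add: "eval_qpoly c f (p + p') = eval_qpoly c f p + eval_qpoly c f p'"
proof -
  let ?K = "Poly_Mapping.keys p \<union> Poly_Mapping.keys p'"
  have "Poly_Mapping.keys (p + p') \<subseteq> ?K" by (rule Poly_Mapping.keys_add)
  thus ?thesis
    by (simp add: eval_superset[of ?K] lookup_add hom_add distrib_right sum.distrib)
qed

lemma eval_single: "eval_qpoly c f (Poly_Mapping.single m a) = c a * monom_value m"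
  by (subst eval_superset[of "{m}"]) (auto simp: hom_zero)

lemma eval_sum: "eval_qpoly c f (sum g A) = (\<Sum>a\<in>A. eval_qpoly c f (g a))"
proof -
  have "eval_qpoly c f 0 = 0" by (simp add: eval_qpoly_def)
  thus ?thesis by (induction A rule: infinite_finite_induct) (auto simp: eval_add)
qed

lemma sum_single_eq: "(\<Sum>m\<in>Poly_Mapping.keys p. Poly_Mapping.single m (Poly_Mapping.lookup p m)) = p"
  by (rule poly_mapping_eqI)
    (auto simp: lookup_sum lookup_single when_def in_keys_iff sum.delta)

lemma eval_mult: "eval_qpoly c f (p * p') = eval_qpoly c f p * eval_qpoly c f p'"
proof -
  let ?s = "\<lambda>p m. Poly_Mapping.single m (Poly_Mapping.lookup p m)"
  have "p * p' = (\<Sum>m\<in>Poly_Mapping.keys p. ?s p m) * (\<Sum>m\<in>Poly_Mapping.keys p'. ?s p' m)"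
    by (simp only: sum_single_eq)
  also have "\<dots> = (\<Sum>m\<in>Poly_Mapping.keys p. \<Sum>m'\<in>Poly_Mapping.keys p'. Poly_Mapping.single (m + m')
      (Poly_Mapping.lookup p m * Poly_Mapping.lookup p' m'))"
    by (simp add: sum_product mult_single)
  finally show ?thesis
    by (simp add: eval_sum eval_single hom_mult monom_value_add eval_superset[OF _ order_refl]
        sum_product mult_ac)
qed

sublocale eval: unital_hom "eval_qpoly c f"
proof
  have "eval_qpoly c f (Poly_Mapping.single 0 1) = 1"
    unfolding eval_single by (simp add: monom_value_def hom_one)
  thus "eval_qpoly c f 1 = 1" by simp
qed (simp_all add: eval_add eval_mult)

lemma eval_scalar: "eval_qpoly c f (scalar a) = c a"
  by (simp add: scalar_def eval_single monom_value_def)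

lemma eval_var: "eval_qpoly c f (var v) = f v"
  by (simp add: var_def eval_single monom_value_def hom_one)

end

lemma unital_hom_scalar: "unital_hom scalar"
  by unfold_locales (simp_all add: scalar_def single_add mult_single)

section \<open>Subalgebras of a polynomial ring and their quotients\<close>

lemma type_ring [simp]:
  "carrier (ring_of_type_algebra :: 'a::comm_ring_1 ring) = UNIV"
  "x \<otimes>\<^bsub>ring_of_type_algebra\<^esub> y = x * (y :: 'a)"
  "x \<oplus>\<^bsub>ring_of_type_algebra\<^esub> y = x + (y :: 'a)"
  "\<one>\<^bsub>ring_of_type_algebra\<^esub> = (1 :: 'a)"
  "\<zero>\<^bsub>ring_of_type_algebra\<^esub> = (0 :: 'a)"
  by (simp_all add: ring_of_type_algebra_def)

lemma type_ring_a_inv [simp]: "\<ominus>\<^bsub>ring_of_type_algebra\<^esub> x = - (x :: 'a::comm_ring_1)"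
proof -
  interpret ring "ring_of_type_algebra :: 'a ring" by (rule ring_from_type_algebra)
  show ?thesis by (rule minus_equality) simp_all
qed

lemma adjoin_ops [simp]:
  "x \<otimes>\<^bsub>adjoin S\<^esub> y = x * y" "x \<oplus>\<^bsub>adjoin S\<^esub> y = x + y" "\<one>\<^bsub>adjoin S\<^esub> = 1" "\<zero>\<^bsub>adjoin S\<^esub> = 0"
  by (simp_all add: adjoin_def)

lemma adjoin_ring: "ring (adjoin S)"
  unfolding adjoin_def by (intro ring.generate_ring_is_ring ring_from_type_algebra) simp

lemma carrier_adjoin: "carrier (adjoin S) = generate_ring ring_of_type_algebra (range scalar \<union> S)"
  by (simp add: adjoin_def)

lemma adjoin_scalar: "scalar c \<in> carrier (adjoin S)"
  and adjoin_incl: "s \<in> S \<Longrightarrow> s \<in> carrier (adjoin S)"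
  by (auto simp: carrier_adjoin intro: generate_ring.incl)

lemma adjoin_induct [consumes 1, case_names scalar incl add mult]:
  assumes "p \<in> carrier (adjoin S)"
    and "\<And>c. P (scalar c)" and "\<And>s. s \<in> S \<Longrightarrow> P s"
    and "\<And>p p'. p \<in> carrier (adjoin S) \<Longrightarrow> p' \<in> carrier (adjoin S) \<Longrightarrow> P p \<Longrightarrow> P p' \<Longrightarrow> P (p + p')"
    and "\<And>p p'. p \<in> carrier (adjoin S) \<Longrightarrow> p' \<in> carrier (adjoin S) \<Longrightarrow> P p \<Longrightarrow> P p' \<Longrightarrow> P (p * p')"
  shows "P p"
  using assms(1) unfolding carrier_adjoin
proof (induction rule: generate_ring.induct)
  case one
  from assms(2)[of 1] show ?case by (simp add: scalar_def)
next
  case (a_inv p)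
  have "- p = scalar (- 1) * p" by (simp add: scalar_def single_uminus)
  with a_inv assms(2)[of "- 1"] assms(5)[of "scalar (- 1)" p] show ?case
    by (simp add: carrier_adjoin generate_ring.incl)
qed (use assms in \<open>auto simp: carrier_adjoin\<close>)

lemma adjoin_uminus: "p \<in> carrier (adjoin S) \<Longrightarrow> - p \<in> carrier (adjoin S)"
  unfolding carrier_adjoin by (drule generate_ring.a_inv) simp

lemma adjoin_add: "p \<in> carrier (adjoin S) \<Longrightarrow> p' \<in> carrier (adjoin S) \<Longrightarrow> p + p' \<in> carrier (adjoin S)"
  unfolding carrier_adjoin by (drule (1) generate_ring.eng_add) simp

lemma adjoin_mult: "p \<in> carrier (adjoin S) \<Longrightarrow> p' \<in> carrier (adjoin S) \<Longrightarrow> p * p' \<in> carrier (adjoin S)"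
  unfolding carrier_adjoin by (drule (1) generate_ring.eng_mult) simp

lemma adjoin_zero: "0 \<in> carrier (adjoin S)" and adjoin_one: "1 \<in> carrier (adjoin S)"
  using adjoin_scalar[of 0 S] adjoin_scalar[of 1 S] by (simp_all add: scalar_def)

lemma adjoin_diff: "p \<in> carrier (adjoin S) \<Longrightarrow> p' \<in> carrier (adjoin S) \<Longrightarrow> p - p' \<in> carrier (adjoin S)"
  using adjoin_add[of p S "- p'"] adjoin_uminus[of p' S] by simp

lemma adjoin_power: "p \<in> carrier (adjoin S) \<Longrightarrow> p ^ r \<in> carrier (adjoin S)"
  by (induction r) (auto intro: adjoin_one adjoin_mult)

lemma adjoin_of_nat: "of_nat r \<in> carrier (adjoin S)"
  by (induction r) (auto intro: adjoin_zero adjoin_one adjoin_add)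

lemma adjoin_sum: "(\<And>a. a \<in> A \<Longrightarrow> f a \<in> carrier (adjoin S)) \<Longrightarrow> sum f A \<in> carrier (adjoin S)"
  by (induction A rule: infinite_finite_induct) (auto intro: adjoin_zero adjoin_add)

lemmas adjoin_closed = adjoin_zero adjoin_one adjoin_scalar adjoin_uminus adjoin_add adjoin_diff
  adjoin_mult adjoin_power adjoin_of_nat adjoin_sum

text \<open>
  Apply the first isomorphism theorem to \<open>h\<close> followed by the projection modulo \<open>J\<close>.
\<close>

lemma quotient_ring_iso:
  assumes R: "ring R" and h: "h \<in> ring_iso R S" and I: "ideal I R" and J: "ideal J S"
    and IJ: "\<And>x. x \<in> carrier R \<Longrightarrow> x \<in> I \<longleftrightarrow> h x \<in> J"
  shows "\<exists>\<Xi>\<in>ring_iso (R Quot I) (S Quot J). \<forall>x\<in>carrier R. \<Xi> (I +>\<^bsub>R\<^esub> x) = J +>\<^bsub>S\<^esub> h x"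
proof -
  interpret J: ideal J S by (rule J)
  interpret I: ideal I R by (rule I)
  let ?g = "\<lambda>x. J +>\<^bsub>S\<^esub> h x"
  have hom: "h \<in> ring_hom R S" and bij: "h ` carrier R = carrier S"
    using h by (auto simp: ring_iso_def bij_betw_def)
  have "ring_hom_ring R (S Quot J) (((+>\<^bsub>S\<^esub>) J) \<circ> h)"
    by (intro ring_hom_ringI2 R J.quotient_is_ring ring_hom_trans[OF hom J.rcos_ring_hom])
  then interpret g: ring_hom_ring R "S Quot J" ?g by (simp add: comp_def)
  have ker: "a_kernel R (S Quot J) ?g = I"
  proof -
    have mem: "?g x = J \<longleftrightarrow> x \<in> I" if "x \<in> carrier R" for x
    proof -
      have hx: "h x \<in> carrier S" using hom that by (rule ring_hom_closed)
      have "?g x = J \<longleftrightarrow> h x \<in> J"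
        using J.a_rcos_self[OF hx] J.a_rcos_const by auto
      thus ?thesis using IJ[OF that] by simp
    qed
    have "a_kernel R (S Quot J) ?g = {x \<in> carrier R. ?g x = J}"
      unfolding a_kernel_def' by (simp add: FactRing_def)
    also have "\<dots> = I" using mem I.a_subset by blast
    finally show ?thesis .
  qed
  have "?g ` carrier R = carrier (S Quot J)"
  proof -
    have "?g ` carrier R = (\<lambda>y. J +>\<^bsub>S\<^esub> y) ` carrier S" by (simp only: bij[symmetric] image_image)
    also have "\<dots> = carrier (S Quot J)" by (auto simp: FactRing_simps)
    finally show ?thesis .
  qed
  note iso = g.FactRing_iso_set[OF this, unfolded ker]
  show ?thesis
    by (rule bexI[OF _ iso]) (use g.the_elem_simp[unfolded ker] in simp)
qed

text \<open>
  Comparing two sets of generators across an isomorphism: it suffices that every ideal of the target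
  contains both sets or neither, because images and preimages of ideals are ideals.
\<close>

lemma genideal_ring_iso:
  assumes R: "ring R" and S: "ring S" and h: "h \<in> ring_iso R S"
    and A: "A \<subseteq> carrier R" and B: "B \<subseteq> carrier S"
    and AB: "\<And>J. ideal J S \<Longrightarrow> h ` A \<subseteq> J \<longleftrightarrow> B \<subseteq> J"
    and x: "x \<in> carrier R"
  shows "x \<in> Idl\<^bsub>R\<^esub> A \<longleftrightarrow> h x \<in> Idl\<^bsub>S\<^esub> B"
proof
  let ?g = "inv_into (carrier R) h"
  have hom: "h \<in> ring_hom R S" and bij: "bij_betw h (carrier R) (carrier S)"
    using h by (auto simp: ring_iso_def)
  have gh: "?g (h y) = y" if "y \<in> carrier R" for y
    using bij that by (simp add: bij_betw_def)
  interpret R: ring R by (rule R)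
  interpret S: ring S by (rule S)
  interpret h: ring_hom_ring R S h by (intro ring_hom_ringI2 R S hom)
  have "?g \<in> ring_iso S R" by (rule ring_iso_set_sym[OF R h])
  then interpret g: ring_hom_ring S R ?g
    by (intro ring_hom_ringI2 R S) (simp add: ring_iso_def)
  have IB: "ideal (Idl\<^bsub>S\<^esub> B) S" using B by (rule S.genideal_ideal)
  have IA: "ideal (Idl\<^bsub>R\<^esub> A) R" using A by (rule R.genideal_ideal)
  have "h ` A \<subseteq> Idl\<^bsub>S\<^esub> B" using AB[OF IB] S.genideal_self[OF B] by simp
  hence "Idl\<^bsub>R\<^esub> A \<subseteq> {r \<in> carrier R. h r \<in> Idl\<^bsub>S\<^esub> B}"
    using A by (intro R.genideal_minimal h.ideal_vimage IB) auto
  thus "x \<in> Idl\<^bsub>R\<^esub> A \<Longrightarrow> h x \<in> Idl\<^bsub>S\<^esub> B" by blast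
  have J: "ideal {s \<in> carrier S. ?g s \<in> Idl\<^bsub>R\<^esub> A} S" by (rule g.ideal_vimage[OF IA])
  have "h ` A \<subseteq> {s \<in> carrier S. ?g s \<in> Idl\<^bsub>R\<^esub> A}"
    using A R.genideal_self[OF A] ring_hom_closed[OF hom] gh by (auto simp: subset_iff)
  hence "Idl\<^bsub>S\<^esub> B \<subseteq> {s \<in> carrier S. ?g s \<in> Idl\<^bsub>R\<^esub> A}"
    using AB[OF J] by (intro S.genideal_minimal J) simp
  thus "h x \<in> Idl\<^bsub>S\<^esub> B \<Longrightarrow> x \<in> Idl\<^bsub>R\<^esub> A" using gh[OF x] by auto
qed

lemma image_adjoin_subset:
  fixes S :: "'v qpoly set" and T :: "'w qpoly set" and f :: "'v qpoly \<Rightarrow> 'w qpoly"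
  assumes "unital_hom f" "\<And>c. f (scalar c) = scalar c" "\<And>s. s \<in> S \<Longrightarrow> f s \<in> carrier (adjoin T)"
    and "p \<in> carrier (adjoin S)"
  shows "f p \<in> carrier (adjoin T)"
proof -
  interpret f: unital_hom f by fact
  show ?thesis using assms(4)
    by (induction rule: adjoin_induct) (auto simp: f.hom_simps assms(2,3) intro: adjoin_closed)
qed

lemma unital_homs_eq_on_adjoin:
  assumes "unital_hom f" "unital_hom g" "\<And>c. f (scalar c) = g (scalar c)" "\<And>s. s \<in> S \<Longrightarrow> f s = g s"
    and "p \<in> carrier (adjoin S)"
  shows "f p = g p"
proof -
  interpret f: unital_hom f by fact
  interpret g: unital_hom g by fact
  show ?thesis using assms(5)
    by (induction rule: adjoin_induct) (auto simp: f.hom_simps g.hom_simps assms(3,4))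
qed

lemma unital_hom_comp: "unital_hom f \<Longrightarrow> unital_hom g \<Longrightarrow> unital_hom (\<lambda>x. g (f x))"
  by (simp add: unital_hom_def)

section \<open>Elements with prescribed elementary symmetric polynomials\<close>

lemma prod_linear_factors:
  fixes x :: "nat \<Rightarrow> 'a::comm_ring_1"
  shows "(\<Prod>i\<in>{1..m}. [:- x i, 1:]) = (\<Sum>i\<le>m. monom ((- 1) ^ i * elem_sym m x i) (m - i))"
proof -
  have "(\<Prod>i\<in>{1..m}. [:- x i, 1:]) = (\<Prod>i\<in>{1..m}. monom 1 1 - [:x i:])"
    by (simp add: monom_altdef)
  also have "\<dots> = (\<Sum>A\<in>Pow {1..m}. (- 1) ^ card A * (\<Prod>i\<in>A. [:x i:]) * (\<Prod>i\<in>{1..m} - A. monom 1 1))"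
    by (rule prod_diff_conv_sum) simp
  also have "\<dots> = (\<Sum>A\<in>Pow {1..m}. monom ((- 1) ^ card A * (\<Prod>i\<in>A. x i)) (m - card A))"
  proof (intro sum.cong refl)
    fix A assume A: "A \<in> Pow {1..m}"
    have "(\<Prod>i\<in>A. [:x i:]) = [:\<Prod>i\<in>A. x i:]"
      by (induction A rule: infinite_finite_induct) (auto simp: one_pCons)
    moreover have "card ({1..m} - A) = m - card A" using A by (subst card_Diff_subset) (auto dest: finite_subset)
    moreover have "(- 1 :: 'a poly) ^ r = [:(- 1) ^ r:]" for r
      by (induction r) (auto simp: one_pCons)
    ultimately show "(- 1) ^ card A * (\<Prod>i\<in>A. [:x i:]) * (\<Prod>i\<in>{1..m} - A. monom 1 1) =
        monom ((- 1) ^ card A * (\<Prod>i\<in>A. x i)) (m - card A)"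
      by (simp add: monom_power smult_monom)
  qed
  also have "\<dots> = (\<Sum>i\<le>m. \<Sum>A | A \<in> Pow {1..m} \<and> card A = i. monom ((- 1) ^ card A * (\<Prod>i\<in>A. x i)) (m - card A))"
    by (rule sum.group[symmetric]) (auto intro: card_mono[of "{1..m}", simplified])
  also have "\<dots> = (\<Sum>i\<le>m. monom ((- 1) ^ i * elem_sym m x i) (m - i))"
    by (intro sum.cong refl) (auto simp: elem_sym_def sum_distrib_left monom_sum intro!: sum.cong)
  finally show ?thesis .
qed

text \<open>
  By Vieta's formulas, the roots of \<open>\<Sum>\<^sub>i (-1)\<^sup>i a\<^sub>i X\<^bsup>m-i\<^esup>\<close> with \<open>a\<^sub>0 = 1\<close> are such elements.
\<close>

lemma exists_roots_with_elem_sym: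
  fixes a :: "nat \<Rightarrow> 'a::alg_closed_field"
  shows "\<exists>x. \<forall>i\<in>{1..m}. elem_sym m x i = a i"
proof -
  let ?a = "a(0 := 1)"
  define p where "p = (\<Sum>i\<le>m. monom ((- 1) ^ i * ?a i) (m - i))"
  have coeff: "coeff (\<Sum>i\<le>m. monom ((- 1) ^ i * b i) (m - i)) (m - j) = (- 1) ^ j * b j"
    if "j \<le> m" for b :: "nat \<Rightarrow> 'a" and j
  proof -
    have "coeff (\<Sum>i\<le>m. monom ((- 1) ^ i * b i) (m - i)) (m - j) =
        (\<Sum>i\<le>m. if i = j then (- 1) ^ j * b j else 0)"
      unfolding coeff_sum using that by (intro sum.cong refl) auto
    thus ?thesis using that by simp
  qed
  have "coeff p m = 1" using coeff[of 0 ?a] by (simp add: p_def)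
  moreover have "degree p \<le> m" unfolding p_def
    by (intro degree_sum_le) (auto intro: order_trans[OF degree_monom_le])
  moreover have "m \<le> degree p" using \<open>coeff p m = 1\<close> by (intro le_degree) simp
  ultimately have p: "degree p = m" "lead_coeff p = 1" "p \<noteq> 0" by (auto simp: antisym)
  then obtain M where M: "size M = m" "p = (\<Prod>r\<in>#M. [:- r, 1:])"
    using alg_closed_imp_factorization[of p] by auto
  obtain rs where rs: "mset rs = M" using ex_mset by blast
  define x where "x = (\<lambda>i. rs ! (i - 1))"
  have "(\<Prod>r\<in>#M. [:- r, 1:]) = (\<Prod>r\<leftarrow>rs. [:- r, 1:])"
    unfolding rs[symmetric] by (induction rs) auto
  also have "\<dots> = (\<Prod>i<m. [:- (rs ! i), 1:])"
    using M(1) rs by (auto simp: prod.list_conv_set_nth lessThan_atLeast0)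
  also have "\<dots> = (\<Prod>i\<in>{1..m}. [:- x i, 1:])"
    by (rule prod.reindex_bij_witness[of _ "\<lambda>i. i - 1" Suc]) (auto simp: x_def)
  also have "\<dots> = (\<Sum>i\<le>m. monom ((- 1) ^ i * elem_sym m x i) (m - i))"
    by (rule prod_linear_factors)
  finally have eq: "(\<Sum>i\<le>m. monom ((- 1) ^ i * ?a i) (m - i)) =
      (\<Sum>i\<le>m. monom ((- 1) ^ i * elem_sym m x i) (m - i))"
    using M(2) unfolding p_def by simp
  have "elem_sym m x i = a i" if "i \<in> {1..m}" for i
    using coeff[of i ?a] coeff[of i "elem_sym m x"] that unfolding eq by simp
  thus ?thesis by blast
qed

text \<open>
  The system that expresses the \<open>e\<^sub>l\<close> by the one-column Grothendieck polynomials is unitriangular, so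
  these are its only solution.
\<close>

lemma groth_col_unique:
  assumes e: "\<And>l. l \<in> {1..k} \<Longrightarrow>
      elem_sym k x l = (\<Sum>j = l..k. of_nat ((j - 1) choose (j - l)) * g j)"
    and "j \<in> {1..k}"
  shows "groth_col k x j = g j"
  using assms(2)
proof (induction "k - j" arbitrary: j rule: less_induct)
  case less
  hence j: "1 \<le> j" "j \<le> k" by auto
  have "(\<Sum>i = Suc j..k. of_nat ((i - 1) choose (i - j)) * groth_col k x i) =
     (\<Sum>i = Suc j..k. of_nat ((i - 1) choose (i - j)) * g i)"
    using less j by (intro sum.cong refl) (auto simp: less)
  moreover have "(\<Sum>i = j..k. of_nat ((i - 1) choose (i - j)) * groth_col k x i) =
     (\<Sum>i = j..k. of_nat ((i - 1) choose (i - j)) * g i)"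
    using elem_sym_eq_groth_col[OF j, of x] e[of j] j by simp
  ultimately show ?case using j by (simp add: sum.atLeast_Suc_atMost[of j])
qed

text \<open>
  Polynomials form an integral domain as soon as their monomials can be ordered compatibly with
  multiplication. Any linear order on the variables induces such an order.
\<close>

instantiation gk_var :: linorder
begin

fun gk_var_rank :: "gk_var \<Rightarrow> nat" where
  "gk_var_rank (VarH r) = 2 * r"
| "gk_var_rank (VarE r) = 2 * r + 1"

definition less_eq_gk_var :: "gk_var \<Rightarrow> gk_var \<Rightarrow> bool" where
  "less_eq_gk_var v w \<longleftrightarrow> gk_var_rank v \<le> gk_var_rank w"

definition less_gk_var :: "gk_var \<Rightarrow> gk_var \<Rightarrow> bool" where
  "less_gk_var v w \<longleftrightarrow> gk_var_rank v < gk_var_rank w"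

instance
proof
  fix v w :: gk_var
  assume "v \<le> w" "w \<le> v"
  thus "v = w" by (cases v; cases w) (auto simp: less_eq_gk_var_def, presburger+)
qed (auto simp: less_eq_gk_var_def less_gk_var_def)

end

definition gk_embed :: "gk_var qpoly \<Rightarrow> gk_var qpoly fract alg_closure" where
  "gk_embed p = to_ac (to_fract p)"

lemma unital_hom_gk_embed: "unital_hom gk_embed"
  by unfold_locales (simp_all add: gk_embed_def)

lemma inj_gk_embed: "inj gk_embed"
  by (auto simp: gk_embed_def inj_def)

section \<open>The relations in the variables of the Coulomb branch\<close>

text \<open>
  The defining formula of \<open>G\<^bsub>1^r\<^esub>\<close> is not meant for \<open>r = 0\<close>, where \<open>E\<^sub>0 = 1\<close> requires the value \<open>1\<close>.
\<close>

definition groth_col0 :: "nat \<Rightarrow> (nat \<Rightarrow> 'a::comm_ring_1) \<Rightarrow> nat \<Rightarrow> 'a" where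
  "groth_col0 k x r = (if r = 0 then 1 else groth_col k x r)"

text \<open>
  By Pascal's rule. The generating function \<open>\<Sum>\<^sub>r (E\<^sub>r - E\<^bsub>r+1\<^esub>) t\<^sup>r\<close> therefore becomes
  \<open>\<Sum>\<^sub>i e\<^sub>i (t - 1)\<^sup>i = \<Prod>\<^sub>i (1 + (t - 1) z\<^sub>i)\<close>.
\<close>

lemma groth_col0_diff:
  "groth_col0 k x r - groth_col0 k x (Suc r) =
     (\<Sum>i = r..k. (- 1) ^ (i - r) * of_nat (i choose r) * elem_sym k x i)"
proof (cases "r \<le> k")
  case True
  define c :: "nat \<Rightarrow> nat" where "c i = (if r = 0 then if i = 0 then 1 else 0 else (i - 1) choose (r - 1))" for i
  have low: "groth_col0 k x r = (\<Sum>i = r..k. (- 1) ^ (i - r) * of_nat (c i) * elem_sym k x i)"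
  proof (cases "r = 0")
    case True
    have "(\<Sum>i = 0..k. (- 1) ^ i * of_nat (c i) * elem_sym k x i) =
        (\<Sum>i\<in>{0}. (- 1) ^ i * of_nat (c i) * elem_sym k x i)"
      using True by (intro sum.mono_neutral_right) (auto simp: c_def)
    thus ?thesis using True by (simp add: groth_col0_def c_def)
  qed (simp add: groth_col0_def groth_col_def c_def)
  have "groth_col0 k x (Suc r) =
      (\<Sum>i = Suc r..k. - ((- 1) ^ (i - r) * of_nat ((i - 1) choose r) * elem_sym k x i))"
    unfolding groth_col0_def groth_col_def
  proof (simp, intro sum.cong refl)
    fix i assume "i \<in> {Suc r..k}"
    hence "i - r = Suc (i - Suc r)" by auto
    thus "(- 1) ^ (i - Suc r) * of_nat (i - Suc 0 choose r) * elem_sym k x i =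
      - ((- 1) ^ (i - r) * of_nat (i - Suc 0 choose r) * elem_sym k x i)" by simp
  qed
  moreover have "elem_sym k x r * of_nat (c r) = elem_sym k x r"
    by (simp add: c_def)
  moreover have "(\<Sum>i = Suc r..k. (- 1) ^ (i - r) * of_nat (i choose r) * elem_sym k x i) =
      (\<Sum>i = Suc r..k. (- 1) ^ (i - r) * of_nat (c i) * elem_sym k x i) +
      (\<Sum>i = Suc r..k. (- 1) ^ (i - r) * of_nat ((i - 1) choose r) * elem_sym k x i)"
    unfolding sum.distrib[symmetric]
  proof (intro sum.cong refl)
    fix i assume "i \<in> {Suc r..k}"
    then obtain i' where "i = Suc i'" by (cases i) auto
    hence "i choose r = c i + (i - 1 choose r)" by (cases r) (auto simp: c_def)
    thus "(- 1) ^ (i - r) * of_nat (i choose r) * elem_sym k x i =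
        (- 1) ^ (i - r) * of_nat (c i) * elem_sym k x i +
        (- 1) ^ (i - r) * of_nat ((i - 1) choose r) * elem_sym k x i"
      by (simp add: algebra_simps)
  qed
  ultimately show ?thesis
    using True by (simp add: low sum.atLeast_Suc_atMost[of r] sum_negf mult.commute)
qed (simp add: groth_col0_def groth_col_def)

text \<open>
  The right-hand side is \<open>\<Prod>\<^sub>i (x\<^sub>i - \<xi>)\<close>. Conceptually, \<open>E(\<xi>) = \<Prod>\<^sub>i (\<xi> + (1 - \<xi>) x\<^sub>i)\<close> and the substitution
  \<open>\<ominus>\<xi> = -\<xi> / (1 - \<xi>)\<close> turns each factor into \<open>(x\<^sub>i - \<xi>) / (1 - \<xi>)\<close>. In coefficients, the binomial
  theorem collapses the sum over \<open>r\<close> to \<open>((1 - \<xi>) + \<xi>)\<^sup>i = 1\<close>.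
\<close>

lemma E_series_numerator:
  fixes x :: "nat \<Rightarrow> 'a::comm_ring_1"
  shows "(1 - fps_X) ^ k * (\<Sum>r = 0..k. fps_const (groth_col0 k x r - groth_col0 k x (r + 1)) * ominus_xi ^ (k - r)) =
    (\<Sum>i\<le>k. fps_const (elem_sym k x i) * (- fps_X) ^ (k - i))"
proof -
  let ?X = "fps_X :: 'a fps"
  have "(1 - ?X) ^ k * (\<Sum>r = 0..k. fps_const (groth_col0 k x r - groth_col0 k x (r + 1)) * ominus_xi ^ (k - r)) =
     (\<Sum>r\<le>k. fps_const (groth_col0 k x r - groth_col0 k x (Suc r)) * ((- ?X) ^ (k - r) * (1 - ?X) ^ r))"
    unfolding sum_distrib_left
  proof (intro sum.cong)
    fix r assume "r \<in> {..k}"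
    hence split: "(1 - ?X) ^ k = (1 - ?X) ^ (k - r) * (1 - ?X) ^ r" by (simp flip: power_add)
    have ominus: "(- ?X) ^ (k - r) = (1 - ?X) ^ (k - r) * ominus_xi ^ (k - r)"
      by (simp only: ominus_xi[symmetric] power_mult_distrib)
    show "(1 - ?X) ^ k * (fps_const (groth_col0 k x r - groth_col0 k x (r + 1)) * ominus_xi ^ (k - r)) =
       fps_const (groth_col0 k x r - groth_col0 k x (Suc r)) * ((- ?X) ^ (k - r) * (1 - ?X) ^ r)"
      unfolding split ominus by (simp only: mult_ac Suc_eq_plus1)
  qed auto
  also have "\<dots> = (\<Sum>r\<le>k. \<Sum>i = r..k. fps_const (elem_sym k x i) * ((- 1) ^ (i - r) * of_nat (i choose r) *
      ((- ?X) ^ (k - r) * (1 - ?X) ^ r)))"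
  proof (intro sum.cong refl)
    fix r
    have "fps_const (groth_col0 k x r - groth_col0 k x (Suc r)) =
      (\<Sum>i = r..k. fps_const ((- 1) ^ (i - r) * of_nat (i choose r) * elem_sym k x i))"
      by (simp only: groth_col0_diff) (rule fps_ext, simp add: fps_sum_nth)
    also have "\<dots> = (\<Sum>i = r..k. fps_const (elem_sym k x i) * ((- 1) ^ (i - r) * of_nat (i choose r)))"
      by (intro sum.cong refl)
        (simp add: fps_of_nat mult_ac flip: fps_const_mult fps_const_power fps_const_neg fps_const_1_eq_1)
    finally show "fps_const (groth_col0 k x r - groth_col0 k x (Suc r)) * ((- ?X) ^ (k - r) * (1 - ?X) ^ r) =
      (\<Sum>i = r..k. fps_const (elem_sym k x i) * ((- 1) ^ (i - r) * of_nat (i choose r) *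
      ((- ?X) ^ (k - r) * (1 - ?X) ^ r)))"
      by (simp add: sum_distrib_right mult.assoc)
  qed
  also have "\<dots> = (\<Sum>i\<le>k. \<Sum>r\<le>i. fps_const (elem_sym k x i) * ((- 1) ^ (i - r) * of_nat (i choose r) *
      ((- ?X) ^ (k - r) * (1 - ?X) ^ r)))"
    unfolding sum.Sigma[OF finite_atMost ballI[OF finite_atMost]]
      sum.Sigma[OF finite_atMost ballI[OF finite_atLeastAtMost]]
    by (rule sum.reindex_bij_witness[of _ "\<lambda>(a, b). (b, a)" "\<lambda>(a, b). (b, a)"]) auto
  also have "\<dots> = (\<Sum>i\<le>k. fps_const (elem_sym k x i) * (- ?X) ^ (k - i))"
  proof (intro sum.cong refl)
    fix i assume i: "i \<in> {..k}"
    have "(\<Sum>r\<le>i. (- 1) ^ (i - r) * of_nat (i choose r) * ((- ?X) ^ (k - r) * (1 - ?X) ^ r)) =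
       (\<Sum>r\<le>i. (- ?X) ^ (k - i) * (of_nat (i choose r) * (1 - ?X) ^ r * ?X ^ (i - r)))"
    proof (intro sum.cong refl)
      fix r assume "r \<in> {..i}"
      hence split: "(- ?X) ^ (k - r) = (- ?X) ^ (k - i) * (- ?X) ^ (i - r)" using i by (simp flip: power_add)
      have sign: "(- ?X) ^ (i - r) = (- 1) ^ (i - r) * ?X ^ (i - r)" by (rule power_minus)
      have one: "(- 1 :: 'a fps) ^ (i - r) * (- 1) ^ (i - r) = 1" by (simp flip: power_mult_distrib)
      show "(- 1) ^ (i - r) * of_nat (i choose r) * ((- ?X) ^ (k - r) * (1 - ?X) ^ r) =
         (- ?X) ^ (k - i) * (of_nat (i choose r) * (1 - ?X) ^ r * ?X ^ (i - r))"
      proof -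
        have "(- 1) ^ (i - r) * of_nat (i choose r) * ((- ?X) ^ (k - r) * (1 - ?X) ^ r) =
           ((- 1) ^ (i - r) * (- 1) ^ (i - r)) * ((- ?X) ^ (k - i) * (of_nat (i choose r) * (1 - ?X) ^ r * ?X ^ (i - r)))"
          unfolding split sign by (simp only: mult_ac)
        thus ?thesis unfolding one by (simp only: mult_1)
      qed
    qed
    also have "\<dots> = (- ?X) ^ (k - i) * ((1 - ?X) + ?X) ^ i"
      by (simp only: binomial_ring sum_distrib_left)
    finally show "(\<Sum>r\<le>i. fps_const (elem_sym k x i) * ((- 1) ^ (i - r) * of_nat (i choose r) *
      ((- ?X) ^ (k - r) * (1 - ?X) ^ r))) = fps_const (elem_sym k x i) * (- ?X) ^ (k - i)"
      by (simp flip: sum_distrib_left)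
  qed
  finally show ?thesis .
qed

text \<open>
  The relation \<open>R\<^sub>l\<close> of the Coulomb branch ring with \<open>n = k + m\<close>, the variables and \<open>q\<close> being replaced by
  elements of an arbitrary ring.
\<close>

definition coulomb_rel :: "nat \<Rightarrow> nat \<Rightarrow> (nat \<Rightarrow> 'a) \<Rightarrow> (nat \<Rightarrow> 'a) \<Rightarrow> 'a \<Rightarrow> nat \<Rightarrow> 'a::comm_ring_1" where
  "coulomb_rel k m x y q l = (\<Sum>i\<le>l. elem_sym k x i * elem_sym m y (l - i)) -
     (alternating_tail k x (Suc l) + (- 1) ^ m * q * of_nat ((k - 1) choose (k + m - l)))"

text \<open>
  The Gorbounov-Korff relation, multiplied by \<open>(1 - \<xi>)\<^sup>k\<close>, after the substitutions \<open>H\<^sub>r = (-1)\<^sup>r e\<^sub>r(y)\<close> and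
  \<open>E\<^sub>r = G\<^bsub>1^r\<^esub>(x)\<close>.
\<close>

definition gk_numerator :: "nat \<Rightarrow> nat \<Rightarrow> (nat \<Rightarrow> 'a) \<Rightarrow> (nat \<Rightarrow> 'a) \<Rightarrow> 'a \<Rightarrow> 'a::comm_ring_1 fps" where
  "gk_numerator k m x y q =
     (\<Sum>r = 0..m. fps_const ((- 1) ^ r * (elem_sym m y r + elem_sym m y (Suc r))) * fps_X ^ (m - r)) *
     (\<Sum>i\<le>k. fps_const (elem_sym k x i) * (- fps_X) ^ (k - i)) -
     ((- fps_X) ^ k * fps_X ^ m * fps_const (1 + elem_sym m y 1) + fps_const q * (1 - fps_X) ^ k)"

text \<open>
  The coefficient of \<open>\<xi>\<^bsup>n-l\<^esup>\<close> in the product is \<open>\<plusminus> \<Sum>\<^sub>i e\<^sub>i(x) (e\<^bsub>l-i\<^esub>(y) + e\<^bsub>l+1-i\<^esub>(y))\<close>, the sum of the left-hand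
  sides of the Coulomb branch relations \<open>l\<close> and \<open>l + 1\<close> up to the term \<open>e\<^bsub>l+1\<^esub>(x)\<close>. That term is
  \<open>c\<^bsub>\<ge>l+1\<^esub> + c\<^bsub>\<ge>l+2\<^esub>\<close>, and by Pascal's rule the \<open>q\<close>-terms of the two relations add up to the coefficient of
  \<open>q (1 - \<xi>)\<^sup>k\<close>. The leading coefficient, \<open>l = 0\<close>, cancels against the term with \<open>1 - H\<^sub>1\<close>.
\<close>

lemma gk_numerator_eq:
  fixes x y :: "nat \<Rightarrow> 'a::comm_ring_1"
  assumes k: "0 < k" and m: "0 < m"
  shows "gk_numerator k m x y q = (\<Sum>l = 1..k + m. fps_const ((- 1) ^ (k + l) *
     (coulomb_rel k m x y q l + (if l < k + m then coulomb_rel k m x y q (Suc l) else 0))) * fps_X ^ (k + m - l))"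
proof -
  let ?X = "fps_X :: 'a fps"
  let ?e = "elem_sym k x" and ?f = "elem_sym m y"
  define S where "S = (\<lambda>l. \<Sum>i\<le>l. ?e i * ?f (l - i))"
  have S': "(\<Sum>i\<le>l. ?e i * ?f (Suc (l - i))) = S (Suc l) - ?e (Suc l)" for l
    by (simp add: S_def Suc_diff_le)
  have prod: "(\<Sum>r = 0..m. fps_const ((- 1) ^ r * (?f r + ?f (Suc r))) * ?X ^ (m - r)) *
     (\<Sum>i\<le>k. fps_const (?e i) * (- ?X) ^ (k - i)) =
     (\<Sum>l\<le>k + m. fps_const ((- 1) ^ (k + l) * (S l + S (Suc l) - ?e (Suc l))) * ?X ^ (k + m - l))"
  proof -
    define t where "t = (\<lambda>r i. fps_const ((- 1) ^ (k + (r + i)) * (?e i * (?f r + ?f (Suc r)))) * ?X ^ (k + m - (r + i)))"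
    have "(\<Sum>r = 0..m. fps_const ((- 1) ^ r * (?f r + ?f (Suc r))) * ?X ^ (m - r)) *
       (\<Sum>i\<le>k. fps_const (?e i) * (- ?X) ^ (k - i)) = (\<Sum>r\<in>{0..m}. \<Sum>i\<in>{..k}. t r i)"
      unfolding sum_product
    proof (intro sum.cong refl)
      fix r i assume ri: "r \<in> {0..m}" "i \<in> {..k}"
      have "(- ?X) ^ (k - i) = fps_const ((- 1) ^ (k - i)) * ?X ^ (k - i)"
        by (subst power_minus) (simp flip: fps_const_power fps_const_neg)
      moreover have "(- 1 :: 'a) ^ (k - i) = (- 1) ^ (k + i)" using ri by (auto simp: minus_one_power_iff)
      moreover have "?X ^ (k + m - (r + i)) = ?X ^ (m - r) * ?X ^ (k - i)"
        using ri by (simp flip: power_add)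
      ultimately show "fps_const ((- 1) ^ r * (?f r + ?f (Suc r))) * ?X ^ (m - r) * (fps_const (?e i) * (- ?X) ^ (k - i)) = t r i"
        by (simp add: t_def power_add mult_ac flip: fps_const_mult)
    qed
    \<comment> \<open>The triangle \<open>i \<le> l \<le> k + m\<close> is larger than the rectangle, but \<open>t\<close> vanishes on the rest of it.\<close>
    also have "\<dots> = (\<Sum>l\<le>k + m. \<Sum>i\<le>l. t (l - i) i)"
      unfolding sum.Sigma[OF finite_atMost ballI[OF finite_atMost]]
        sum.Sigma[OF finite_atLeastAtMost ballI[OF finite_atMost]]
    proof (rule sum.reindex_bij_witness_not_neutral[of "{}" "{(l, i). l \<le> k + m \<and> i \<le> l \<and> (i > k \<or> l - i > m)}"
          _ "\<lambda>(l, i). (l - i, i)" "\<lambda>(r, i). (r + i, i)"])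
      show "finite {(l, i). l \<le> k + m \<and> i \<le> l \<and> (i > k \<or> l - i > m)}"
        by (rule finite_subset[of _ "{..k + m} \<times> {..k + m}"]) auto
    qed (auto simp: t_def elem_sym_eq_0)
    also have "\<dots> = (\<Sum>l\<le>k + m. fps_const ((- 1) ^ (k + l) * (S l + S (Suc l) - ?e (Suc l))) * ?X ^ (k + m - l))"
    proof (intro sum.cong refl)
      fix l
      have "(\<Sum>i\<le>l. t (l - i) i) = (\<Sum>i\<le>l. fps_const ((- 1) ^ (k + l) * (?e i * (?f (l - i) + ?f (Suc (l - i)))))) * ?X ^ (k + m - l)"
        unfolding t_def sum_distrib_right by (intro sum.cong) auto
      also have "(\<Sum>i\<le>l. fps_const ((- 1) ^ (k + l) * (?e i * (?f (l - i) + ?f (Suc (l - i)))))) =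
         fps_const (\<Sum>i\<le>l. (- 1) ^ (k + l) * (?e i * (?f (l - i) + ?f (Suc (l - i)))))"
        by (rule fps_ext) (simp add: fps_sum_nth)
      also have "(\<Sum>i\<le>l. (- 1) ^ (k + l) * (?e i * (?f (l - i) + ?f (Suc (l - i))))) =
          (- 1) ^ (k + l) * (S l + S (Suc l) - ?e (Suc l))"
        by (simp add: S_def distrib_left sum.distrib Suc_diff_le flip: sum_distrib_left)
      finally show "(\<Sum>i\<le>l. t (l - i) i) = fps_const ((- 1) ^ (k + l) * (S l + S (Suc l) - ?e (Suc l))) * ?X ^ (k + m - l)" .
    qed
    finally show ?thesis .
  qed
  have qpart: "(1 - ?X) ^ k = (\<Sum>l\<le>k + m. fps_const ((- 1) ^ (k + l) * ((- 1) ^ m * of_nat (k choose (k + m - l)))) * ?X ^ (k + m - l))"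
  proof -
    have "(1 - ?X) ^ k = (- ?X + 1) ^ k" by simp
    also have "\<dots> = (\<Sum>s\<le>k. of_nat (k choose s) * (- ?X) ^ s)" by (simp only: binomial_ring power_one mult_1_right)
    also have "\<dots> = (\<Sum>s\<le>k + m. of_nat (k choose s) * (- ?X) ^ s)"
      by (intro sum.mono_neutral_left ballI) (simp_all add: binomial_eq_0)
    also have "\<dots> = (\<Sum>l\<le>k + m. of_nat (k choose (k + m - l)) * (- ?X) ^ (k + m - l))"
      by (rule sum.reindex_bij_witness[of _ "\<lambda>l. k + m - l" "\<lambda>s. k + m - s"]) auto
    also have "\<dots> = (\<Sum>l\<le>k + m. fps_const ((- 1) ^ (k + l) * ((- 1) ^ m * of_nat (k choose (k + m - l)))) * ?X ^ (k + m - l))"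
    proof (intro sum.cong refl)
      fix l assume "l \<in> {..k + m}"
      hence "(- 1 :: 'a) ^ (k + m - l) = (- 1) ^ (k + l) * (- 1) ^ m"
        by (auto simp: minus_one_power_iff)
      moreover have "(- ?X) ^ (k + m - l) = fps_const ((- 1) ^ (k + m - l)) * ?X ^ (k + m - l)"
        by (subst power_minus) (simp flip: fps_const_power fps_const_neg)
      ultimately show "of_nat (k choose (k + m - l)) * (- ?X) ^ (k + m - l) =
          fps_const ((- 1) ^ (k + l) * ((- 1) ^ m * of_nat (k choose (k + m - l)))) * ?X ^ (k + m - l)"
        by (simp add: fps_of_nat[symmetric] mult_ac flip: fps_const_mult)
    qed
    finally show ?thesis .
  qed
  define p where "p = (\<lambda>l. (- 1) ^ (k + l) * (S l + S (Suc l) - ?e (Suc l) - (- 1) ^ m * q * of_nat (k choose (k + m - l))))"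
  have "gk_numerator k m x y q = (\<Sum>l\<le>k + m. fps_const (p l) * ?X ^ (k + m - l)) - (- ?X) ^ k * ?X ^ m * fps_const (1 + ?f 1)"
  proof -
    have "(\<Sum>l\<le>k + m. fps_const (p l) * ?X ^ (k + m - l)) =
      (\<Sum>l\<le>k + m. fps_const ((- 1) ^ (k + l) * (S l + S (Suc l) - ?e (Suc l))) * ?X ^ (k + m - l)) -
      fps_const q * (\<Sum>l\<le>k + m. fps_const ((- 1) ^ (k + l) * ((- 1) ^ m * of_nat (k choose (k + m - l)))) * ?X ^ (k + m - l))"
      unfolding sum_distrib_left sum_subtractf[symmetric]
    proof (intro sum.cong refl)
      fix l
      have "p l = (- 1) ^ (k + l) * (S l + S (Suc l) - ?e (Suc l)) -
          q * ((- 1) ^ (k + l) * ((- 1) ^ m * of_nat (k choose (k + m - l))))"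
        by (simp add: p_def algebra_simps)
      thus "fps_const (p l) * ?X ^ (k + m - l) =
          fps_const ((- 1) ^ (k + l) * (S l + S (Suc l) - ?e (Suc l))) * ?X ^ (k + m - l) -
          fps_const q * (fps_const ((- 1) ^ (k + l) * ((- 1) ^ m * of_nat (k choose (k + m - l)))) * ?X ^ (k + m - l))"
        by (simp only: fps_const_sub[symmetric] left_diff_distrib mult.assoc[symmetric]) (simp only: fps_const_mult mult.assoc)
    qed
    thus ?thesis unfolding gk_numerator_def prod qpart[symmetric] by simp
  qed
  also have "(\<Sum>l\<le>k + m. fps_const (p l) * ?X ^ (k + m - l)) =
      fps_const (p 0) * ?X ^ (k + m) + (\<Sum>l = 1..k + m. fps_const (p l) * ?X ^ (k + m - l))"
    by (simp add: sum.atLeast_Suc_atMost[of 0] flip: atLeast0AtMost)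
  also have "fps_const (p 0) * ?X ^ (k + m) = (- ?X) ^ k * ?X ^ m * fps_const (1 + ?f 1)"
  proof -
    have "p 0 = (- 1) ^ k * (1 + ?f 1)" using m by (simp add: p_def S_def binomial_eq_0)
    thus ?thesis
      by (subst power_minus) (simp add: power_add mult_ac flip: fps_const_mult fps_const_power fps_const_neg)
  qed
  also have "(\<Sum>l = 1..k + m. fps_const (p l) * ?X ^ (k + m - l)) = (\<Sum>l = 1..k + m. fps_const ((- 1) ^ (k + l) *
     (coulomb_rel k m x y q l + (if l < k + m then coulomb_rel k m x y q (Suc l) else 0))) * ?X ^ (k + m - l))"
  proof (intro sum.cong refl)
    fix l assume l: "l \<in> {1..k + m}"
    have "p l = (- 1) ^ (k + l) * (coulomb_rel k m x y q l + (if l < k + m then coulomb_rel k m x y q (Suc l) else 0))"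
    proof (cases "l < k + m")
      case True
      then obtain s where s: "k + m - l = Suc s" using Suc_diff_Suc by metis
      moreover obtain k' where "k = Suc k'" using k by (cases k) auto
      moreover have "k + m - Suc l = s" using s by simp
      ultimately have "k choose (k + m - l) = (k - 1 choose (k + m - l)) + (k - 1 choose (k + m - Suc l))" by simp
      moreover have "?e (Suc l) = alternating_tail k x (Suc l) + alternating_tail k x (Suc (Suc l))"
        using alternating_tail_Suc[of k x "Suc l"] by (simp add: algebra_simps)
      ultimately show ?thesis using True
        by (simp add: p_def coulomb_rel_def S_def algebra_simps)
    next
      case False
      hence l': "l = k + m" using l by simp
      have "S (Suc l) = 0" unfolding S_def
      proof (intro sum.neutral ballI)
        fix i show "?e i * ?f (Suc l - i) = 0"
          using l' by (cases "k < i") (simp_all add: elem_sym_eq_0)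
      qed
      moreover have "?e (Suc l) = 0" using l' by (simp add: elem_sym_eq_0)
      moreover have "alternating_tail k x (Suc l) = 0" using l' by (simp add: alternating_tail_def)
      ultimately show ?thesis using l' by (simp add: p_def coulomb_rel_def S_def)
    qed
    thus "fps_const (p l) * ?X ^ (k + m - l) = fps_const ((- 1) ^ (k + l) *
     (coulomb_rel k m x y q l + (if l < k + m then coulomb_rel k m x y q (Suc l) else 0))) * ?X ^ (k + m - l)"
      by simp
  qed
  finally show ?thesis by simp
qed

definition map_fps :: "('a \<Rightarrow> 'b) \<Rightarrow> 'a fps \<Rightarrow> 'b fps" where
  "map_fps f F = Abs_fps (\<lambda>i. f (fps_nth F i))"

lemma map_fps_nth [simp]: "fps_nth (map_fps f F) i = f (fps_nth F i)"
  by (simp add: map_fps_def)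

context unital_hom begin

lemma unital_hom_map_fps: "unital_hom (map_fps h)"
  by unfold_locales (auto simp: fps_eq_iff fps_mult_nth hom_simps)

lemma map_fps_const: "map_fps h (fps_const a) = fps_const (h a)"
  by (simp add: fps_eq_iff hom_zero)

lemma map_fps_X: "map_fps h fps_X = fps_X"
  by (simp add: fps_eq_iff fps_X_def hom_zero hom_one)

lemma map_fps_ominus_xi: "map_fps h ominus_xi = ominus_xi"
  by (simp add: fps_eq_iff ominus_xi_def hom_simps)

end

text \<open>
  Multiplication by \<open>1 - X\<close> replaces the coefficients by their successive differences, from which
  they are recovered as partial sums.
\<close>

lemma coeffs_mult_one_minus_X:
  fixes F :: "'a::comm_ring_1 fps"
  assumes "\<And>a b. a \<in> I \<Longrightarrow> b \<in> I \<Longrightarrow> a + b \<in> I" "\<And>a. a \<in> I \<Longrightarrow> - a \<in> I"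
  shows "(\<forall>i. fps_nth ((1 - fps_X) * F) i \<in> I) \<longleftrightarrow> (\<forall>i. fps_nth F i \<in> I)"
proof -
  have coeff: "fps_nth ((1 - fps_X) * F) i = (if i = 0 then fps_nth F 0 else fps_nth F i - fps_nth F (i - 1))" for i
    by (simp add: left_diff_distrib)
  have diff: "a - b \<in> I" if "a \<in> I" "b \<in> I" for a b
    using assms(1)[of a "- b"] assms(2)[of b] that by simp
  show ?thesis
  proof
    assume *: "\<forall>i. fps_nth ((1 - fps_X) * F) i \<in> I"
    show "\<forall>i. fps_nth F i \<in> I"
    proof
      fix i show "fps_nth F i \<in> I"
      proof (induction i)
        case 0 show ?case using *[rule_format, of 0] by (simp add: coeff)
      next
        case (Suc i) thus ?case using assms(1)[OF *[rule_format, of "Suc i"] Suc] by (simp add: coeff)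
      qed
    qed
  qed (auto simp: coeff diff)
qed

lemma coeffs_mult_one_minus_X_power:
  fixes F :: "'a::comm_ring_1 fps"
  assumes "\<And>a b. a \<in> I \<Longrightarrow> b \<in> I \<Longrightarrow> a + b \<in> I" "\<And>a. a \<in> I \<Longrightarrow> - a \<in> I"
  shows "(\<forall>i. fps_nth ((1 - fps_X) ^ k * F) i \<in> I) \<longleftrightarrow> (\<forall>i. fps_nth F i \<in> I)"
  using assms
proof (induction k)
  case (Suc k)
  thus ?case using coeffs_mult_one_minus_X[of I "(1 - fps_X) ^ k * F"] by (simp add: mult.assoc)
qed simp

text \<open>
  Passing between the \<open>R\<^sub>l\<close> and the sums \<open>R\<^sub>l + R\<^bsub>l+1\<^esub>\<close> takes only additions and sign changes, with a
  downward induction from \<open>R\<^bsub>n+1\<^esub> = 0\<close> in one direction.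
\<close>

lemma gk_numerator_coeffs:
  fixes x y :: "nat \<Rightarrow> 'a::comm_ring_1"
  assumes k: "0 < k" and m: "0 < m" and zero: "0 \<in> I"
    and add: "\<And>a b. a \<in> I \<Longrightarrow> b \<in> I \<Longrightarrow> a + b \<in> I" and uminus: "\<And>a. a \<in> I \<Longrightarrow> - a \<in> I"
  shows "(\<forall>i. fps_nth (gk_numerator k m x y q) i \<in> I) \<longleftrightarrow> (\<forall>l\<in>{1..k + m}. coulomb_rel k m x y q l \<in> I)"
proof -
  let ?n = "k + m"
  let ?R = "\<lambda>l. if l \<le> ?n then coulomb_rel k m x y q l else 0"
  have coeff: "fps_nth (gk_numerator k m x y q) (?n - l) = (- 1) ^ (k + l) * (?R l + ?R (Suc l))"
    if "l \<in> {1..?n}" for l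
  proof -
    have "fps_nth (gk_numerator k m x y q) (?n - l) =
       (\<Sum>l'\<in>{1..?n}. if l' = l then (- 1) ^ (k + l) * (?R l + ?R (Suc l)) else 0)"
      unfolding gk_numerator_eq[OF k m] fps_sum_nth using that
      by (intro sum.cong refl) (auto simp: fps_X_power_nth)
    thus ?thesis using that by simp
  qed
  have coeff0: "fps_nth (gk_numerator k m x y q) i = 0" if "?n \<le> i" for i
    unfolding gk_numerator_eq[OF k m] fps_sum_nth using that
    by (intro sum.neutral) (auto simp: fps_X_power_nth)
  have sign: "(- 1) ^ r * a \<in> I \<longleftrightarrow> a \<in> I" for r a
    using uminus[of a] uminus[of "- a"] by (auto simp: minus_one_power_iff)
  have "(\<forall>i. fps_nth (gk_numerator k m x y q) i \<in> I) \<longleftrightarrow> (\<forall>l\<in>{1..?n}. ?R l + ?R (Suc l) \<in> I)"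
  proof
    assume *: "\<forall>i. fps_nth (gk_numerator k m x y q) i \<in> I"
    show "\<forall>l\<in>{1..?n}. ?R l + ?R (Suc l) \<in> I" using * coeff sign by metis
  next
    assume *: "\<forall>l\<in>{1..?n}. ?R l + ?R (Suc l) \<in> I"
    show "\<forall>i. fps_nth (gk_numerator k m x y q) i \<in> I"
    proof
      fix i show "fps_nth (gk_numerator k m x y q) i \<in> I"
      proof (cases "i < ?n")
        case True
        hence "?n - i \<in> {1..?n}" "?n - (?n - i) = i" by auto
        thus ?thesis using coeff[of "?n - i"] * sign by metis
      qed (simp add: coeff0 zero)
    qed
  qed
  also have "\<dots> \<longleftrightarrow> (\<forall>l\<in>{1..?n}. ?R l \<in> I)"
  proof
    assume *: "\<forall>l\<in>{1..?n}. ?R l + ?R (Suc l) \<in> I"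
    have R: "?R (Suc l) \<in> I" if "l \<le> ?n" for l
      using that
    proof (induction rule: inc_induct)
      \<comment> \<open>The start is \<open>l = n\<close>, with the conventional value \<open>R\<^bsub>n+1\<^esub> = 0\<close>.\<close>
      case base show ?case by (simp add: zero)
    next
      case (step l)
      have "?R (Suc l) + ?R (Suc (Suc l)) \<in> I" using * step by auto
      from add[OF this uminus[OF step.IH]] show ?case by simp
    qed
    show "\<forall>l\<in>{1..?n}. ?R l \<in> I"
    proof
      fix l assume "l \<in> {1..?n}"
      thus "?R l \<in> I" using R[of "l - 1"] by (cases l) auto
    qed
  next
    assume *: "\<forall>l\<in>{1..?n}. ?R l \<in> I"
    show "\<forall>l\<in>{1..?n}. ?R l + ?R (Suc l) \<in> I"
      using * zero by (auto intro!: add)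
  qed
  finally show ?thesis by simp
qed

section \<open>The isomorphism of polynomial rings\<close>

text \<open>
  The lift sends \<open>H\<^sub>r\<close> to \<open>(-1)\<^sup>r e\<^sub>r(zhat)\<close> and not to \<open>G\<^sub>r(z)\<close>: the two agree only modulo the relations,
  and the image of the latter choice would not contain the \<open>e\<^sub>r(zhat)\<close>.
\<close>

definition xi_lift :: "nat \<Rightarrow> nat \<Rightarrow> gk_var qpoly \<Rightarrow> coulomb_var qpoly" where
  "xi_lift k n = eval_qpoly scalar
     (case_gk_var (\<lambda>r. (- 1) ^ r * elem_sym (n - k) zhat r) (groth_col k z))"

interpretation xi_lift: qpoly_evaluation scalar
    "case_gk_var (\<lambda>r. (- 1) ^ r * elem_sym (n - k) zhat r) (groth_col k z)" for k n
  by (intro qpoly_evaluation.intro unital_hom_scalar)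

lemma unital_hom_xi_lift: "unital_hom (xi_lift k n)"
  unfolding xi_lift_def by (rule xi_lift.eval.unital_hom_axioms)

lemma xi_lift_scalar [simp]: "xi_lift k n (scalar c) = scalar c"
  by (simp add: xi_lift_def xi_lift.eval_scalar)

lemma xi_lift_H: "xi_lift k n (gk_H k n r) = (- 1) ^ r * elem_sym (n - k) zhat r"
  by (auto simp: gk_H_def xi_lift_def xi_lift.eval_var xi_lift.eval.hom_simps elem_sym_eq_0)

lemma xi_lift_E: "xi_lift k n (gk_E k r) = groth_col0 k z r"
  by (auto simp: gk_E_def groth_col0_def xi_lift_def xi_lift.eval_var xi_lift.eval.hom_simps groth_col_def)

definition gk_series :: "nat \<Rightarrow> nat \<Rightarrow> gk_var qpoly fps" where
  "gk_series k n = gk_H_series k n fps_X * gk_E_series k ominus_xi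
      - (ominus_xi ^ k * fps_X ^ (n - k) * fps_const (1 - gk_H k n 1) + fps_const q_elem)"

lemma gk_relations_eq: "gk_relations k n = range (fps_nth (gk_series k n))"
  by (simp add: gk_relations_def gk_series_def)

lemma xi_lift_gk_series:
  "(1 - fps_X) ^ k * map_fps (xi_lift k n) (gk_series k n) = gk_numerator k (n - k) z zhat q_elem"
proof -
  let ?f = "xi_lift k n" and ?m = "n - k"
  interpret f: unital_hom ?f by (rule unital_hom_xi_lift)
  interpret F: unital_hom "map_fps ?f" by (rule f.unital_hom_map_fps)
  let ?H = "\<Sum>r = 0..?m. fps_const ((- 1) ^ r * (elem_sym ?m zhat r + elem_sym ?m zhat (Suc r))) * fps_X ^ (?m - r)"
  let ?E = "\<Sum>r = 0..k. fps_const (groth_col0 k z r - groth_col0 k z (r + 1)) * ominus_xi ^ (k - r)"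
  let ?X = "fps_X :: coulomb_var qpoly fps"
  have "map_fps ?f (gk_series k n) = ?H * ?E -
      (ominus_xi ^ k * ?X ^ ?m * fps_const (1 + elem_sym ?m zhat 1) + fps_const q_elem)"
    by (simp add: gk_series_def gk_H_series_def gk_E_series_def F.hom_simps f.map_fps_const f.map_fps_X
        f.map_fps_ominus_xi f.hom_simps xi_lift_H xi_lift_E q_elem_def algebra_simps del: fps_const_sub fps_const_add)
  hence "(1 - ?X) ^ k * map_fps ?f (gk_series k n) = ?H * ((1 - ?X) ^ k * ?E) -
      (((1 - ?X) * ominus_xi) ^ k * ?X ^ ?m * fps_const (1 + elem_sym ?m zhat 1) + fps_const q_elem * (1 - ?X) ^ k)"
    by (simp only: power_mult_distrib) (simp only: algebra_simps)
  thus ?thesis unfolding E_series_numerator ominus_xi gk_numerator_def .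
qed

lemma coulomb_relations_eq:
  assumes "0 < k" "k < n"
  shows "coulomb_relations k n = coulomb_rel k (n - k) z zhat q_elem ` {1..n}"
proof -
  have sign: "(- 1 :: coulomb_var qpoly) ^ (n + k) = (- 1) ^ (n - k)"
    using assms by (auto simp: minus_one_power_iff)
  show ?thesis unfolding coulomb_relations_def
    using assms by (intro image_cong refl)
      (simp add: g_hat_def c_ge_def coulomb_rel_def alternating_tail_def sign atLeast0AtMost)
qed

lemma ideal_adjoin_closed:
  assumes "ideal I (adjoin S)"
  shows "I \<subseteq> carrier (adjoin S)" "0 \<in> I" "a \<in> I \<Longrightarrow> b \<in> I \<Longrightarrow> a + b \<in> I" "a \<in> I \<Longrightarrow> - a \<in> I"
    "c \<in> carrier (adjoin S) \<Longrightarrow> a \<in> I \<Longrightarrow> c * a \<in> I"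
proof -
  interpret I: ideal I "adjoin S" by fact
  show "I \<subseteq> carrier (adjoin S)" by (rule I.a_subset)
  show "0 \<in> I" using additive_subgroup.zero_closed[OF I.is_additive_subgroup] by simp
  show "a \<in> I \<Longrightarrow> b \<in> I \<Longrightarrow> a + b \<in> I" using additive_subgroup.a_closed[OF I.is_additive_subgroup, of a b] by simp
  show *: "c \<in> carrier (adjoin S) \<Longrightarrow> a \<in> I \<Longrightarrow> c * a \<in> I" for c using I.I_l_closed[of a c] by simp
  show "a \<in> I \<Longrightarrow> - a \<in> I" using *[of "- 1"] by (simp add: adjoin_closed)
qed

lemma relations_in_ideal_iff:
  assumes k: "0 < k" and n: "k < n" and I: "ideal I (coulomb_poly_ring k n)"
  shows "xi_lift k n ` gk_relations k n \<subseteq> I \<longleftrightarrow> coulomb_relations k n \<subseteq> I"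
proof -
  note cl = ideal_adjoin_closed[OF I[unfolded coulomb_poly_ring_def]]
  have "xi_lift k n ` gk_relations k n \<subseteq> I \<longleftrightarrow> (\<forall>i. fps_nth (map_fps (xi_lift k n) (gk_series k n)) i \<in> I)"
    by (auto simp: gk_relations_eq)
  also have "\<dots> \<longleftrightarrow> (\<forall>i. fps_nth (gk_numerator k (n - k) z zhat q_elem) i \<in> I)"
    unfolding xi_lift_gk_series[symmetric] by (rule coeffs_mult_one_minus_X_power[symmetric]) (use cl in auto)
  also have "\<dots> \<longleftrightarrow> (\<forall>l\<in>{1..k + (n - k)}. coulomb_rel k (n - k) z zhat q_elem l \<in> I)"
    using n by (intro gk_numerator_coeffs k cl) auto
  also have "\<dots> \<longleftrightarrow> coulomb_relations k n \<subseteq> I"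
    unfolding coulomb_relations_eq[OF k n] using n by auto
  finally show ?thesis .
qed

lemma gk_generators_in_carrier:
  "gk_H k n r \<in> carrier (gk_poly_ring k n)" "gk_E k r \<in> carrier (gk_poly_ring k n)"
proof -
  show "gk_H k n r \<in> carrier (gk_poly_ring k n)"
  proof (cases "r \<in> {1..n - k}")
    case True thus ?thesis unfolding gk_poly_ring_def by (intro adjoin_incl) auto
  qed (auto simp: gk_H_def gk_poly_ring_def intro: adjoin_closed)
  show "gk_E k r \<in> carrier (gk_poly_ring k n)"
  proof (cases "r \<in> {1..k}")
    case True thus ?thesis unfolding gk_poly_ring_def by (intro adjoin_incl) auto
  qed (auto simp: gk_E_def gk_poly_ring_def intro: adjoin_closed)
qed

lemma coulomb_generators_in_carrier:
  "elem_sym k z i \<in> carrier (coulomb_poly_ring k n)" "elem_sym (n - k) zhat i \<in> carrier (coulomb_poly_ring k n)"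
proof -
  show "elem_sym k z i \<in> carrier (coulomb_poly_ring k n)"
  proof (cases "i \<in> {1..k}")
    case True thus ?thesis unfolding coulomb_poly_ring_def by (intro adjoin_incl) auto
  next
    case False
    hence "i = 0 \<or> k < i" by auto
    thus ?thesis by (auto simp: elem_sym_eq_0 coulomb_poly_ring_def intro: adjoin_closed)
  qed
  show "elem_sym (n - k) zhat i \<in> carrier (coulomb_poly_ring k n)"
  proof (cases "i \<in> {1..n - k}")
    case True thus ?thesis unfolding coulomb_poly_ring_def by (intro adjoin_incl) auto
  next
    case False
    hence "i = 0 \<or> n - k < i" by auto
    thus ?thesis by (auto simp: elem_sym_eq_0 coulomb_poly_ring_def intro: adjoin_closed)
  qed
qed

lemma minus_one_power_in_adjoin: "(- 1) ^ r \<in> carrier (adjoin S)"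
  by (intro adjoin_closed)

lemma groth_col_in_carrier: "groth_col k z j \<in> carrier (coulomb_poly_ring k n)"
  unfolding groth_col_def coulomb_poly_ring_def
  by (intro adjoin_closed coulomb_generators_in_carrier[unfolded coulomb_poly_ring_def])

lemma fps_mult_coeffs_in_adjoin:
  assumes "\<And>i. fps_nth F i \<in> carrier (adjoin S)" "\<And>i. fps_nth G i \<in> carrier (adjoin S)"
  shows "fps_nth (F * G) i \<in> carrier (adjoin S)"
  unfolding fps_mult_nth by (intro adjoin_closed assms)

lemma fps_power_coeffs_in_adjoin:
  assumes "\<And>i. fps_nth F i \<in> carrier (adjoin S)"
  shows "fps_nth (F ^ r) i \<in> carrier (adjoin S)"
proof (induction r arbitrary: i)
  case 0 show ?case by (auto simp: fps_one_nth intro: adjoin_closed)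
next
  case (Suc r) show ?case unfolding power_Suc by (intro fps_mult_coeffs_in_adjoin assms Suc)
qed

lemma gk_relations_in_carrier: "gk_relations k n \<subseteq> carrier (gk_poly_ring k n)"
proof -
  note gens = gk_generators_in_carrier[where k = k and n = n, unfolded gk_poly_ring_def]
  have X: "fps_nth (fps_X :: gk_var qpoly fps) i \<in> carrier (adjoin S)" for i S
    by (auto simp: fps_X_def intro: adjoin_closed)
  have om: "fps_nth (ominus_xi :: gk_var qpoly fps) i \<in> carrier (adjoin S)" for i S
    by (auto simp: ominus_xi_def intro: adjoin_closed)
  have const: "c \<in> carrier (adjoin S) \<Longrightarrow> fps_nth (fps_const c) i \<in> carrier (adjoin S)"
    for c :: "gk_var qpoly" and i S
    by (auto simp: intro: adjoin_closed)
  have "fps_nth (gk_series k n) i \<in> carrier (gk_poly_ring k n)" for i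
    unfolding gk_series_def gk_H_series_def gk_E_series_def gk_poly_ring_def fps_sub_nth fps_add_nth q_elem_def
    by (intro adjoin_diff adjoin_add fps_mult_coeffs_in_adjoin fps_power_coeffs_in_adjoin X om const gens
        adjoin_one adjoin_scalar) (simp_all only: fps_sum_nth, (intro adjoin_sum fps_mult_coeffs_in_adjoin fps_power_coeffs_in_adjoin X om const adjoin_diff gens)+)
  thus ?thesis by (auto simp: gk_relations_eq)
qed

lemma coulomb_relations_in_carrier: "coulomb_relations k n \<subseteq> carrier (coulomb_poly_ring k n)"
  unfolding coulomb_relations_def g_hat_def c_ge_def q_elem_def coulomb_poly_ring_def
  by (intro image_subsetI adjoin_closed coulomb_generators_in_carrier[unfolded coulomb_poly_ring_def])

text \<open>
  Substitute for \<open>z\<close> and \<open>zhat\<close> elements of an algebraically closed field whose elementary symmetric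
  polynomials are the expressions that the generators \<open>E\<^sub>j\<close> and \<open>H\<^sub>j\<close> dictate. The composite with the
  lift fixes these generators, hence is the inclusion into that field.
\<close>

lemma exists_left_inverse_of_xi_lift:
  "\<exists>\<psi>. unital_hom \<psi> \<and> (\<forall>p\<in>carrier (gk_poly_ring k n). \<psi> (xi_lift k n p) = gk_embed p)"
proof -
  interpret e: unital_hom gk_embed by (rule unital_hom_gk_embed)
  let ?m = "n - k"
  obtain x where x: "\<And>l. l \<in> {1..k} \<Longrightarrow>
      elem_sym k x l = (\<Sum>j = l..k. of_nat ((j - 1) choose (j - l)) * gk_embed (gk_E k j))"
    using exists_roots_with_elem_sym[of k "\<lambda>l. \<Sum>j = l..k. of_nat ((j - 1) choose (j - l)) * gk_embed (gk_E k j)"]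
    by blast
  obtain y where y: "\<And>j. j \<in> {1..?m} \<Longrightarrow> elem_sym ?m y j = (- 1) ^ j * gk_embed (gk_H k n j)"
    using exists_roots_with_elem_sym[of ?m "\<lambda>j. (- 1) ^ j * gk_embed (gk_H k n j)"] by blast
  define c where "c = (\<lambda>a. gk_embed (scalar a))"
  have c: "unital_hom c" unfolding c_def by (rule unital_hom_comp[OF unital_hom_scalar unital_hom_gk_embed])
  define \<psi> where "\<psi> = eval_qpoly c (case_coulomb_var x y)"
  interpret \<psi>: qpoly_evaluation c "case_coulomb_var x y" by (intro qpoly_evaluation.intro c)
  have hom: "unital_hom \<psi>" unfolding \<psi>_def by (rule \<psi>.eval.unital_hom_axioms)
  interpret h: unital_hom \<psi> by (rule hom)
  have vars: "\<psi> (z a) = x a" "\<psi> (zhat a) = y a" "\<psi> (scalar b) = c b" for a b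
    by (simp_all add: \<psi>_def \<psi>.eval_var \<psi>.eval_scalar)
  have "\<psi> (xi_lift k n p) = gk_embed p" if "p \<in> carrier (gk_poly_ring k n)" for p
  proof (rule unital_homs_eq_on_adjoin[OF unital_hom_comp[OF unital_hom_xi_lift hom] unital_hom_gk_embed])
    show "p \<in> carrier (adjoin (gk_H k n ` {1..?m} \<union> gk_E k ` {1..k}))"
      using that by (simp add: gk_poly_ring_def)
    show "\<psi> (xi_lift k n (scalar a)) = gk_embed (scalar a)" for a by (simp add: vars c_def)
    fix s assume "s \<in> gk_H k n ` {1..?m} \<union> gk_E k ` {1..k}"
    then consider j where "j \<in> {1..?m}" "s = gk_H k n j" | j where "j \<in> {1..k}" "s = gk_E k j" by blast
    thus "\<psi> (xi_lift k n s) = gk_embed s"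
    proof cases
      case 1
      hence "\<psi> (xi_lift k n s) = (- 1) ^ j * ((- 1) ^ j * gk_embed (gk_H k n j))"
        using y by (simp add: xi_lift_H h.hom_simps h.hom_elem_sym vars)
      thus ?thesis using 1 by (simp add: mult.assoc[symmetric] flip: power_mult_distrib)
    next
      case 2
      hence "\<psi> (xi_lift k n s) = groth_col k x j"
        by (simp add: xi_lift_E groth_col0_def h.hom_groth_col vars)
      thus ?thesis using 2 groth_col_unique[OF x] by simp
    qed
  qed
  with hom show ?thesis by blast
qed

text \<open>
  Injectivity comes from the left inverse. For surjectivity, the \<open>e\<^sub>i(z)\<close> are integral combinations of
  the one-column Grothendieck polynomials.
\<close>

lemma xi_lift_iso: "xi_lift k n \<in> ring_iso (gk_poly_ring k n) (coulomb_poly_ring k n)"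
proof (rule ring_iso_memI)
  let ?f = "xi_lift k n" and ?P = "gk_poly_ring k n" and ?C = "coulomb_poly_ring k n"
  interpret f: unital_hom ?f by (rule unital_hom_xi_lift)
  show closed: "?f p \<in> carrier ?C" if "p \<in> carrier ?P" for p
    unfolding coulomb_poly_ring_def
  proof (rule image_adjoin_subset[OF unital_hom_xi_lift _ _ that[unfolded gk_poly_ring_def]], goal_cases)
    case (2 s)
    then consider j where "s = gk_H k n j" | j where "j \<in> {1..k}" "s = gk_E k j" by blast
    thus ?case
    proof cases
      case 1 thus ?thesis unfolding 1 xi_lift_H
        by (intro adjoin_closed coulomb_generators_in_carrier[unfolded coulomb_poly_ring_def])
    next
      case 2 thus ?thesis
        using groth_col_in_carrier[of k j n] by (simp add: xi_lift_E groth_col0_def coulomb_poly_ring_def)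
    qed
  qed simp
  show "?f (p \<otimes>\<^bsub>?P\<^esub> p') = ?f p \<otimes>\<^bsub>?C\<^esub> ?f p'" "?f (p \<oplus>\<^bsub>?P\<^esub> p') = ?f p \<oplus>\<^bsub>?C\<^esub> ?f p'" "?f \<one>\<^bsub>?P\<^esub> = \<one>\<^bsub>?C\<^esub>" for p p'
    by (simp_all add: gk_poly_ring_def coulomb_poly_ring_def f.hom_simps)
  show "bij_betw ?f (carrier ?P) (carrier ?C)"
  proof (rule bij_betw_imageI)
    from exists_left_inverse_of_xi_lift[of k n]
    obtain \<psi> where \<psi>: "\<forall>p\<in>carrier ?P. \<psi> (?f p) = gk_embed p" by (elim exE conjE)
    show "inj_on ?f (carrier ?P)"
    proof (rule inj_onI)
      fix p p' assume "p \<in> carrier ?P" "p' \<in> carrier ?P" "?f p = ?f p'"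
      hence "gk_embed p = gk_embed p'" using \<psi> by metis
      thus "p = p'" using inj_gk_embed by (simp add: inj_eq)
    qed
    have "p \<in> ?f ` carrier ?P" if "p \<in> carrier ?C" for p
      using that unfolding coulomb_poly_ring_def
    proof (induction rule: adjoin_induct)
      case (scalar c)
      have "scalar c = ?f (scalar c)" by simp
      thus ?case unfolding gk_poly_ring_def using adjoin_scalar by blast
    next
      case (incl s)
      then consider i where "i \<in> {1..k}" "s = elem_sym k z i" | j where "s = elem_sym (n - k) zhat j" by blast
      thus ?case
      proof cases
        case 1
        have "s = ?f (\<Sum>j = i..k. of_nat ((j - 1) choose (j - i)) * gk_E k j)"
          using 1 by (simp add: elem_sym_eq_groth_col f.hom_simps xi_lift_E groth_col0_def)
        moreover have "(\<Sum>j = i..k. of_nat ((j - 1) choose (j - i)) * gk_E k j) \<in> carrier ?P"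
          unfolding gk_poly_ring_def by (intro adjoin_closed gk_generators_in_carrier[unfolded gk_poly_ring_def])
        ultimately show ?thesis by blast
      next
        case 2
        have "s = ?f ((- 1) ^ j * gk_H k n j)"
          using 2 by (simp add: f.hom_simps xi_lift_H mult.assoc[symmetric] flip: power_mult_distrib)
        moreover have "(- 1) ^ j * gk_H k n j \<in> carrier ?P"
          unfolding gk_poly_ring_def by (intro adjoin_closed gk_generators_in_carrier[unfolded gk_poly_ring_def])
        ultimately show ?thesis by blast
      qed
    next
      case (add p p')
      then obtain a b where "a \<in> carrier ?P" "b \<in> carrier ?P" "p = ?f a" "p' = ?f b" by blast
      hence "p + p' = ?f (a + b)" "a + b \<in> carrier ?P"
        by (simp_all add: f.hom_simps gk_poly_ring_def adjoin_add)
      thus ?case by blast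
    next
      case (mult p p')
      then obtain a b where "a \<in> carrier ?P" "b \<in> carrier ?P" "p = ?f a" "p' = ?f b" by blast
      hence "p * p' = ?f (a * b)" "a * b \<in> carrier ?P"
        by (simp_all add: f.hom_simps gk_poly_ring_def adjoin_mult)
      thus ?case by blast
    qed
    thus "?f ` carrier ?P = carrier ?C" using closed by blast
  qed
qed

section \<open>The isomorphism of quotients\<close>

text \<open>
  For \<open>l \<le> n - k\<close> the binomial coefficient at \<open>q\<close> vanishes, so subtracting the identity satisfied by the
  \<open>G\<^sub>j\<close> from the relation gives \<open>R\<^sub>l = \<Sum>\<^sub>i e\<^sub>i(z) D\<^bsub>l-i\<^esub>\<close>, where \<open>D\<^sub>j\<close> is the difference in question. As
  \<open>e\<^sub>0 = 1\<close>, the ideal contains \<open>D\<^sub>l\<close> as soon as it contains all earlier \<open>D\<^sub>j\<close>.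
\<close>

lemma elem_sym_zhat_eq_groth_row:
  assumes k: "0 < k" and n: "k < n" and I: "ideal I (coulomb_poly_ring k n)"
    and rel: "coulomb_relations k n \<subseteq> I" and l: "l \<le> n - k"
  shows "elem_sym (n - k) zhat l - (- 1) ^ l * groth_row0 k z l \<in> I"
  using l
proof (induction l rule: less_induct)
  case (less l)
  note cl = ideal_adjoin_closed[OF I[unfolded coulomb_poly_ring_def]]
  let ?D = "\<lambda>l. elem_sym (n - k) zhat l - (- 1) ^ l * groth_row0 k z l"
  show ?case
  proof (cases "l = 0")
    case True thus ?thesis by (simp add: groth_row0_def cl)
  next
    case False
    have "coulomb_rel k (n - k) z zhat q_elem l \<in> I"
      using rel less.prems False n unfolding coulomb_relations_eq[OF k n] by auto
    also have "coulomb_rel k (n - k) z zhat q_elem l = (\<Sum>i\<le>l. elem_sym k z i * ?D (l - i))"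
    proof -
      have no_q: "k - Suc 0 choose (n - l) = 0" using less.prems k n by (intro binomial_eq_0) auto
      thus ?thesis using False n
        by (simp add: no_q coulomb_rel_def sum_elem_sym_groth_row0[OF k, symmetric] right_diff_distrib sum_subtractf)
    qed
    also have "\<dots> = ?D l + (\<Sum>i<l. elem_sym k z (Suc i) * ?D (l - Suc i))"
      by (subst sum.atMost_shift) simp
    finally have total: "?D l + (\<Sum>i<l. elem_sym k z (Suc i) * ?D (l - Suc i)) \<in> I" .
    have rest: "(\<Sum>i\<in>A. elem_sym k z (Suc i) * ?D (l - Suc i)) \<in> I" if "A \<subseteq> {..<l}" for A
      using finite_subset[OF that finite_lessThan] that
    proof (induction A rule: finite_induct)
      case (insert i A)
      have "elem_sym k z (Suc i) * ?D (l - Suc i) \<in> I"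
        using insert.prems less.prems
        by (intro cl(5) less.IH coulomb_generators_in_carrier[unfolded coulomb_poly_ring_def]) auto
      with insert show ?case by (simp add: cl)
    qed (simp add: cl)
    from cl(3)[OF total cl(4)[OF rest[OF order_refl]]] show ?thesis by simp
  qed
qed

theorem proposition12p4:
  fixes k n :: nat
  assumes "0 < k" and "k < n"
  shows "\<exists>\<Xi>. is_Xi k n \<Xi> \<and>
    (\<forall>\<Psi>. is_Xi k n \<Psi> \<longrightarrow> (\<forall>x\<in>carrier (QK_GK k n). \<Psi> x = \<Xi> x)) \<and>
    \<Xi> \<in> ring_iso (QK_GK k n) (QK_hat k n)"
proof -
  let ?P = "gk_poly_ring k n" and ?C = "coulomb_poly_ring k n" and ?f = "xi_lift k n"
  let ?I = "gk_ideal k n" and ?J = "coulomb_ideal k n"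
  have P: "ring ?P" and C: "ring ?C"
    by (simp_all add: gk_poly_ring_def coulomb_poly_ring_def adjoin_ring)
  have I: "ideal ?I ?P" unfolding gk_ideal_def
    by (intro ring.genideal_ideal P gk_relations_in_carrier)
  have J: "ideal ?J ?C" and relJ: "coulomb_relations k n \<subseteq> ?J" unfolding coulomb_ideal_def
    by (intro ring.genideal_ideal ring.genideal_self C coulomb_relations_in_carrier)+
  have "p \<in> ?I \<longleftrightarrow> ?f p \<in> ?J" if "p \<in> carrier ?P" for p
    unfolding gk_ideal_def coulomb_ideal_def using that assms
    by (intro genideal_ring_iso P C xi_lift_iso gk_relations_in_carrier coulomb_relations_in_carrier
        relations_in_ideal_iff)
  from quotient_ring_iso[OF P xi_lift_iso I J this]
  obtain \<Xi> where iso: "\<Xi> \<in> ring_iso (QK_GK k n) (QK_hat k n)"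
    and \<Xi>: "\<And>p. p \<in> carrier ?P \<Longrightarrow> \<Xi> (gk_class k n p) = coulomb_class k n (?f p)"
    unfolding QK_GK_def QK_hat_def gk_class_def coulomb_class_def by blast
  have class_H: "coulomb_class k n (?f (gk_H k n j)) = coulomb_class k n (groth_row k z j)" if "j \<in> {1..n - k}" for j
  proof -
    let ?d = "elem_sym (n - k) zhat j - (- 1) ^ j * groth_row k z j"
    note cl = ideal_adjoin_closed[OF J[unfolded coulomb_poly_ring_def]]
    have "?d \<in> ?J"
      using elem_sym_zhat_eq_groth_row[OF assms J relJ, of j] that by (simp add: groth_row0_def)
    hence d: "(- 1) ^ j * ?d \<in> ?J" by (intro cl minus_one_power_in_adjoin)
    have diff: "(- 1) ^ j * ?d = ?f (gk_H k n j) - groth_row k z j"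
      by (simp add: xi_lift_H right_diff_distrib mult.assoc[symmetric] flip: power_mult_distrib)
    have fH: "?f (gk_H k n j) \<in> carrier ?C"
      using ring_iso_memE(1)[OF xi_lift_iso gk_generators_in_carrier(1)] .
    have "?f (gk_H k n j) - groth_row k z j \<in> carrier ?C"
      using d[unfolded diff] cl(1) unfolding coulomb_poly_ring_def by (rule subsetD[rotated])
    from adjoin_diff[OF fH[unfolded coulomb_poly_ring_def] this[unfolded coulomb_poly_ring_def]]
    have G: "groth_row k z j \<in> carrier ?C" unfolding coulomb_poly_ring_def by simp
    interpret C: ring ?C by (rule C)
    have "\<ominus>\<^bsub>?C\<^esub> groth_row k z j = - groth_row k z j"
      using G by (intro C.minus_equality) (auto simp: coulomb_poly_ring_def adjoin_uminus)
    hence "?f (gk_H k n j) \<ominus>\<^bsub>?C\<^esub> groth_row k z j \<in> ?J"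
      using d[unfolded diff] by (simp add: a_minus_def) (simp add: coulomb_poly_ring_def)
    thus ?thesis unfolding coulomb_class_def
      using C.quotient_eq_iff_same_a_r_cos[OF J fH G] by simp
  qed
  have "is_Xi k n \<Xi>"
    unfolding is_Xi_def QK_alg_hom_def
  proof (intro conjI ballI CollectI allI)
    show "\<Xi> \<in> ring_hom (QK_GK k n) (QK_hat k n)" using iso by (simp add: ring_iso_def)
    show "\<Xi> (gk_class k n (scalar c)) = coulomb_class k n (scalar c)" for c
      using \<Xi>[of "scalar c"] by (simp add: gk_poly_ring_def adjoin_scalar)
    show "\<Xi> (gk_class k n (gk_H k n j)) = coulomb_class k n (groth_row k z j)" if "j \<in> {1..n - k}" for j
      using \<Xi>[OF gk_generators_in_carrier(1)] class_H[OF that] by simp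
    show "\<Xi> (gk_class k n (gk_E k j)) = coulomb_class k n (groth_col k z j)" if "j \<in> {1..k}" for j
      using \<Xi>[OF gk_generators_in_carrier(2), of j] that by (simp add: xi_lift_E groth_col0_def)
  qed
  moreover have "\<Psi> x = \<Xi> x" if \<Psi>: "is_Xi k n \<Psi>" and x: "x \<in> carrier (QK_GK k n)" for \<Psi> x
  proof -
    have hom: "\<Psi> \<in> ring_hom (QK_GK k n) (QK_hat k n)" "\<Xi> \<in> ring_hom (QK_GK k n) (QK_hat k n)"
      using \<Psi> \<open>is_Xi k n \<Xi>\<close> by (auto simp: is_Xi_def QK_alg_hom_def)
    have class_hom: "gk_class k n \<in> ring_hom ?P (QK_GK k n)"
      using ideal.rcos_ring_hom[OF I] unfolding QK_GK_def gk_class_def .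
    from x obtain p where p: "p \<in> carrier ?P" and xp: "x = gk_class k n p"
      unfolding QK_GK_def gk_class_def FactRing_def A_RCOSETS_def' by auto
    have "\<Psi> (gk_class k n p) = \<Xi> (gk_class k n p)"
      using p unfolding gk_poly_ring_def
    proof (induction rule: adjoin_induct)
      case (scalar c)
      thus ?case using \<Psi> \<open>is_Xi k n \<Xi>\<close> by (simp add: is_Xi_def QK_alg_hom_def)
    next
      case (incl s)
      thus ?case using \<Psi> \<open>is_Xi k n \<Xi>\<close> by (auto simp: is_Xi_def)
    next
      case (add p p')
      hence pp: "p \<in> carrier ?P" "p' \<in> carrier ?P" by (simp_all add: gk_poly_ring_def)
      have "gk_class k n (p + p') = gk_class k n p \<oplus>\<^bsub>QK_GK k n\<^esub> gk_class k n p'"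
        using ring_hom_add[OF class_hom pp] by (simp add: gk_poly_ring_def)
      thus ?case using add.IH pp by (simp add: ring_hom_add[OF hom(1)] ring_hom_add[OF hom(2)] ring_hom_closed[OF class_hom])
    next
      case (mult p p')
      hence pp: "p \<in> carrier ?P" "p' \<in> carrier ?P" by (simp_all add: gk_poly_ring_def)
      have "gk_class k n (p * p') = gk_class k n p \<otimes>\<^bsub>QK_GK k n\<^esub> gk_class k n p'"
        using ring_hom_mult[OF class_hom pp] by (simp add: gk_poly_ring_def)
      thus ?case using mult.IH pp by (simp add: ring_hom_mult[OF hom(1)] ring_hom_mult[OF hom(2)] ring_hom_closed[OF class_hom])
    qed
    thus ?thesis by (simp add: xp)
  qed
  ultimately show ?thesis using iso by blast
qed

end
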